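(* Let $X$ be a complex Banach space and $T=(T_1,\ldots,T_n)$ a commuting tuple of bounded linear operators on $X$. Then the sets $sp_{\mathcal{B}_-}(T)$ and $sp_{\mathcal{B}_+}(T)$ are compact subsets of $\mathbb{C}^n$.
   Context: Let $X$ be a complex Banach space and $T=(T_1,\ldots,T_n)$ an $n$-tuple of commuting bounded linear operators on $X$. $R(\cdot)$ and $N(\cdot)$ denote range and null space. For $\lambda\in\mathbb{C}^n$, $T-\lambda=(T_1-\lambda_1I,\ldots,T_n-\lambda_nI)$. Define $\hat{T}\colon X^n\to X$, $\hat{T}(x_1,\ldots,x_n)=T_1x_1+\cdots+T_nx_n$, and $\tilde{T}\colon X\to X^n$, $\tilde{T}(x)=(T_1x,\ldots,T_nx)$. Put $R^\infty(T)=\bigcap_{k\ge1}[R(T_1^k)+\cdots+R(T_n^k)]$ and $N^\infty(T)=\bigcup_{k\ge1}[N(T_1^k)\cap\cdots\cap N(T_n^k)]$. A subspace of a Banach space has a direct complement if there is a closed subspace such that the whole space is the direct sum of the two. $T$ is lower split semi-Browder if $\operatorname{codim}R^\infty(T)<\infty$ and $N(\hat{T})$ has a direct complement in $X^n$. $T$ is upper split semi-Browder if $\dim N(\tilde{T})<\infty$, $R(\tilde{T})$ is closed, $\dim N^\infty(T)<\infty$, and $R(\tilde{T})$ has a direct complement in $X^n$. $sp_{\mathcal{B}_-}(T)$ (respectively $sp_{\mathcal{B}_+}(T)$) is the set of $\lambda\in\mathbb{C}^n$ such that $T-\lambda$ is not lower (respectively upper) split semi-Browder. *)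

theory Defs
  imports "HOL-Analysis.Analysis" "HOL-Library.Set_Algebras"
begin

class complex_vector = real_vector +
  fixes scaleC :: "complex \<Rightarrow> 'a \<Rightarrow> 'a" (infixr "*\<^sub>C" 75)
  assumes scaleC_add_right: "a *\<^sub>C (x + y) = a *\<^sub>C x + a *\<^sub>C y"
    and scaleC_add_left: "(a + b) *\<^sub>C x = a *\<^sub>C x + b *\<^sub>C x"
    and scaleC_scaleC: "a *\<^sub>C b *\<^sub>C x = (a * b) *\<^sub>C x"
    and scaleC_one: "1 *\<^sub>C x = x"
    and scaleR_scaleC: "r *\<^sub>R x = complex_of_real r *\<^sub>C x"

class complex_normed_vector = complex_vector + real_normed_vector +
  assumes norm_scaleC: "norm (a *\<^sub>C x) = cmod a * norm x"

class complex_banach = complex_normed_vector + banach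

global_interpretation complex_vector:
  vector_space "scaleC :: complex \<Rightarrow> 'a \<Rightarrow> 'a::complex_vector"
  defines csubspace = complex_vector.subspace
    and cspan = complex_vector.span
  by unfold_locales (simp_all add: scaleC_add_right scaleC_add_left scaleC_scaleC scaleC_one)

instantiation vec :: (complex_vector, finite) complex_vector
begin

definition scaleC_vec_def: "c *\<^sub>C x = (\<chi> i. c *\<^sub>C (x $ i))"

instance
  by standard
    (simp_all add: scaleC_vec_def vec_eq_iff scaleC_add_right scaleC_add_left scaleC_scaleC
      scaleC_one scaleR_scaleC)

end

instance vec :: (complex_normed_vector, finite) complex_normed_vector
  by standard (simp add: scaleC_vec_def norm_vec_def norm_scaleC L2_set_right_distrib)

instance vec :: (complex_banach, finite) complex_banach ..

definition bounded_clinear :: "('a::complex_normed_vector \<Rightarrow> 'b::complex_normed_vector) \<Rightarrow> bool"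
  where "bounded_clinear f \<longleftrightarrow>
    Vector_Spaces.linear scaleC scaleC f \<and> (\<exists>K. \<forall>x. norm (f x) \<le> norm x * K)"

abbreviation null_space :: "('a \<Rightarrow> 'b::zero) \<Rightarrow> 'a set"
  where "null_space f \<equiv> f -` {0}"

definition finite_cdim :: "'a::complex_vector set \<Rightarrow> bool"
  where "finite_cdim M \<longleftrightarrow> (\<exists>B. finite B \<and> M = cspan B)"

text \<open>The quotient by \<open>M\<close> is spanned by the cosets of finitely many vectors.\<close>

definition finite_ccodim :: "'a::complex_vector set \<Rightarrow> bool"
  where "finite_ccodim M \<longleftrightarrow> (\<exists>B. finite B \<and> (\<forall>x. \<exists>b\<in>cspan B. x - b \<in> M))"

definition has_direct_complement :: "'a::complex_normed_vector set \<Rightarrow> bool"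
  where "has_direct_complement M \<longleftrightarrow>
    (\<exists>L. csubspace L \<and> closed L \<and> M + L = UNIV \<and> M \<inter> L = {0})"

text \<open>
  A tuple of operators on \<open>'a\<close> is a family indexed by the finite type \<open>'n\<close>, and
  \<open>'a ^ 'n\<close> with its Euclidean norm (equivalent to every other product norm) is the
  \<open>n\<close>-fold power of \<open>'a\<close>.
\<close>

definition tuple_hat :: "('n::finite \<Rightarrow> 'a \<Rightarrow> 'a::complex_normed_vector) \<Rightarrow> 'a ^ 'n \<Rightarrow> 'a"
  where "tuple_hat T x = (\<Sum>i\<in>UNIV. T i (x $ i))"

definition tuple_tilde :: "('n::finite \<Rightarrow> 'a \<Rightarrow> 'a::complex_normed_vector) \<Rightarrow> 'a \<Rightarrow> 'a ^ 'n"
  where "tuple_tilde T x = (\<chi> i. T i x)"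

text \<open>The sum below is the elementwise sum of sets from \<^theory>\<open>HOL-Library.Set_Algebras\<close>.\<close>

definition R_infinity :: "('n::finite \<Rightarrow> 'a \<Rightarrow> 'a::complex_normed_vector) \<Rightarrow> 'a set"
  where "R_infinity T = (\<Inter>k\<in>{1..}. \<Sum>i\<in>UNIV. range (T i ^^ k))"

definition N_infinity :: "('n::finite \<Rightarrow> 'a \<Rightarrow> 'a::complex_normed_vector) \<Rightarrow> 'a set"
  where "N_infinity T = (\<Union>k\<in>{1..}. \<Inter>i\<in>UNIV. null_space (T i ^^ k))"

definition lower_split_semi_Browder ::
    "('n::finite \<Rightarrow> 'a \<Rightarrow> 'a::complex_normed_vector) \<Rightarrow> bool"
  where "lower_split_semi_Browder T \<longleftrightarrow>
    finite_ccodim (R_infinity T) \<and> has_direct_complement (null_space (tuple_hat T))"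

definition upper_split_semi_Browder ::
    "('n::finite \<Rightarrow> 'a \<Rightarrow> 'a::complex_normed_vector) \<Rightarrow> bool"
  where "upper_split_semi_Browder T \<longleftrightarrow>
    finite_cdim (null_space (tuple_tilde T)) \<and> closed (range (tuple_tilde T)) \<and>
    finite_cdim (N_infinity T) \<and> has_direct_complement (range (tuple_tilde T))"

definition tuple_shift ::
    "('n::finite \<Rightarrow> 'a \<Rightarrow> 'a::complex_normed_vector) \<Rightarrow> complex ^ 'n \<Rightarrow> 'n \<Rightarrow> 'a \<Rightarrow> 'a"
  where "tuple_shift T z i x = T i x - (z $ i) *\<^sub>C x"

definition sp_lower_split :: "('n::finite \<Rightarrow> 'a \<Rightarrow> 'a::complex_normed_vector) \<Rightarrow> (complex ^ 'n) set"
  where "sp_lower_split T = {z. \<not> lower_split_semi_Browder (tuple_shift T z)}"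

definition sp_upper_split :: "('n::finite \<Rightarrow> 'a \<Rightarrow> 'a::complex_normed_vector) \<Rightarrow> (complex ^ 'n) set"
  where "sp_upper_split T = {z. \<not> upper_split_semi_Browder (tuple_shift T z)}"

end

theory Submission
  imports Defs
begin

text \<open>
  Both spectra are bounded because \<open>T i - z i\<close> is invertible as soon as \<open>z i\<close> exceeds the norm of
  \<open>T i\<close>, and a tuple with an invertible entry is split semi-Browder. They are closed because
  being split semi-Browder is stable under small shifts.

  In the lower case the chain \<open>\<Sum>i. range (T i ^ k)\<close> stabilizes at \<open>M = R_infinity T\<close>, which is
  closed as an operator range of finite codimension, and the tuple maps \<open>M ^ n\<close> onto \<open>M\<close>. The
  shifted tuple still does so by openness of surjections, and iterating this puts \<open>M\<close> inside its
  own \<open>R_infinity\<close>. If \<open>L\<close> complements the kernel of the row operator and \<open>F\<close> is a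
  finite-dimensional complement of its range, then \<open>(l, v) \<mapsto> A l + v\<close> is an isomorphism on
  \<open>L \<times> F\<close> and remains one after the shift, so the new kernel has a complement that is a
  finite-dimensional extension of \<open>L\<close>.

  In the upper case \<open>N = N_infinity T\<close> is finite-dimensional and the column operator \<open>A\<close> satisfies
  \<open>A x \<in> N ^ n \<Longrightarrow> x \<in> N\<close>. With a closed complement \<open>W\<close> of \<open>N\<close> (Hahn-Banach), the map
  \<open>(w, m) \<mapsto> A w + m\<close> is bounded below on \<open>W \<times> N ^ n\<close>, so the implication persists under small
  shifts and bounds \<open>N_infinity\<close> of the shifted tuple by \<open>N\<close>. The range is handled like the
  kernel in the lower case.
\<close>

section \<open>Perturbation of surjections between Banach spaces\<close>

text \<open>Successive approximation: correcting the residual again and again shrinks it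
  geometrically, and the corrections sum absolutely to an exact preimage in \<open>S\<close>. The
  set \<open>Q\<close> holds the residuals, so a correction need only exist where it is used. Both
  the open mapping theorem and the stability of surjections come out of this.\<close>

lemma onto_from_approximation:
  fixes f :: "'p::banach \<Rightarrow> 'q::real_normed_vector"
  assumes f: "bounded_linear f" and S: "subspace S" "closed S"
    and c: "0 \<le> c" and q: "0 \<le> q" "q < 1"
    and step: "\<And>y. y \<in> Q \<Longrightarrow> \<exists>x\<in>S. norm x \<le> c * norm y \<and> norm (y - f x) \<le> q * norm y \<and> y - f x \<in> Q"
    and y: "y \<in> Q"
  shows "\<exists>x\<in>S. f x = y \<and> norm x \<le> c / (1 - q) * norm y"
proof -
  interpret f: bounded_linear f by fact
  obtain h where h: "\<And>y. y \<in> Q \<Longrightarrow> h y \<in> S" "\<And>y. y \<in> Q \<Longrightarrow> norm (h y) \<le> c * norm y"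
      "\<And>y. y \<in> Q \<Longrightarrow> norm (y - f (h y)) \<le> q * norm y" "\<And>y. y \<in> Q \<Longrightarrow> y - f (h y) \<in> Q"
    using step by metis
  \<comment> \<open>\<open>r n\<close> is what is left of \<open>y\<close> after \<open>n\<close>
    corrections, that is, \<open>y\<close> minus \<open>f\<close> of the partial sum of the
    \<open>h (r i)\<close>.\<close>
  define r where "r n = ((\<lambda>y. y - f (h y)) ^^ n) y" for n
  have rS: "r (Suc n) = r n - f (h (r n))" for n by (simp add: r_def)
  have rQ: "r n \<in> Q" for n by (induction n) (use y h(4) in \<open>auto simp: r_def\<close>)
  have rn: "norm (r n) \<le> q ^ n * norm y" for n
  proof (induction n)
    case (Suc n)
    have "norm (r (Suc n)) \<le> q * norm (r n)" unfolding rS using h(3) rQ by blast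
    also have "\<dots> \<le> q * (q ^ n * norm y)" using Suc q by (intro mult_left_mono)
    finally show ?case by simp
  qed (simp add: r_def)
  have hn: "norm (h (r n)) \<le> c * norm y * q ^ n" for n
    using h(2)[OF rQ, of n] mult_left_mono[OF rn[of n] c] by (simp add: algebra_simps)
  have geo: "summable (\<lambda>n. c * norm y * q ^ n)" "(\<Sum>n. c * norm y * q ^ n) = c / (1 - q) * norm y"
    using q by (auto simp: suminf_mult suminf_geometric intro!: summable_mult summable_geometric)
  have sn: "summable (\<lambda>n. norm (h (r n)))"
    by (rule summable_comparison_test[OF _ geo(1)]) (use hn in auto)
  define x where "x = (\<Sum>n. h (r n))"
  have lim: "(\<lambda>n. \<Sum>i<n. h (r i)) \<longlonglongrightarrow> x"
    unfolding x_def by (rule summable_LIMSEQ[OF summable_norm_cancel[OF sn]])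
  have "x \<in> S"
  proof (rule closed_sequentially[OF S(2) _ lim])
    show "\<And>n. (\<Sum>i<n. h (r i)) \<in> S" using h(1) rQ S(1) by (auto intro: subspace_sum)
  qed
  moreover have "f x = y"
  proof -
    have "f (\<Sum>i<n. h (r i)) = y - r n" for n
      by (induction n) (auto simp: r_def f.zero f.add)
    moreover have "(\<lambda>n. f (\<Sum>i<n. h (r i))) \<longlonglongrightarrow> f x" by (rule f.tendsto[OF lim])
    moreover have "r \<longlonglongrightarrow> 0"
    proof (rule Lim_null_comparison)
      show "\<forall>\<^sub>F n in sequentially. norm (r n) \<le> q ^ n * norm y" using rn by auto
      show "(\<lambda>n. q ^ n * norm y) \<longlonglongrightarrow> 0"
        using q by (intro tendsto_mult_left_zero LIMSEQ_realpow_zero) auto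
    qed
    then have "(\<lambda>n. y - r n) \<longlonglongrightarrow> y - 0" by (intro tendsto_intros)
    ultimately show ?thesis using LIMSEQ_unique by fastforce
  qed
  moreover have "norm x \<le> c / (1 - q) * norm y"
    unfolding x_def geo(2)[symmetric]
    using summable_norm[OF sn] suminf_le[OF hn sn geo(1)] by linarith
  ultimately show ?thesis by blast
qed

text \<open>Baire's theorem in the image, which is complete because it is closed, gives approximate
  preimages of controlled norm; the preceding iteration makes them exact.\<close>

lemma open_mapping_onto_closed:
  fixes f :: "'p::banach \<Rightarrow> 'q::banach"
  assumes f: "bounded_linear f" and S: "subspace S" "closed S" and Q: "closed (f ` S)"
  obtains c where "c > 0" "\<And>y. y \<in> f ` S \<Longrightarrow> \<exists>x\<in>S. f x = y \<and> norm x \<le> c * norm y"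
proof -
  interpret f: bounded_linear f by fact
  define Q where "Q = f ` S"
  have subQ: "subspace Q" unfolding Q_def using S(1) f.linear_axioms by (rule linear_subspace_image[rotated])
  \<comment> \<open>The sets are kept inside \<open>Q\<close> because Baire's theorem is applied to
    \<open>Q\<close> as a space of its own; in the whole space \<open>Q\<close> may have empty
    interior.\<close>
  define G where "G n = Q \<inter> closure (f ` (S \<inter> cball 0 (real n)))" for n :: nat
  have "\<exists>n. top_of_set Q interior_of G n \<noteq> {}"
  proof (rule ccontr)
    assume neg: "\<not> ?thesis"
    have cms: "completely_metrizable_space (top_of_set Q)"
      by (rule completely_metrizable_space_closedin[OF completely_metrizable_space_euclidean])
        (use Q in \<open>simp add: Q_def\<close>)
    have "top_of_set Q interior_of \<Union>(range G) = {}"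
    proof (intro Baire_category_alt disjI1)
      fix V assume "V \<in> range G"
      then obtain n where n: "V = G n" by blast
      have "closedin (top_of_set Q) V" unfolding n G_def by (simp add: closedin_closed_Int)
      then show "closedin (top_of_set Q) V \<and> top_of_set Q interior_of V = {}" using neg n by blast
    qed (use cms in \<open>simp_all add: countable_image\<close>)
    moreover have "\<Union>(range G) = Q"
    proof
      show "Q \<subseteq> \<Union>(range G)"
      proof
        fix y assume "y \<in> Q"
        then obtain x where x: "x \<in> S" "y = f x" by (auto simp: Q_def)
        obtain n where "norm x \<le> real n" using real_arch_simple by blast
        then have "y \<in> f ` (S \<inter> cball 0 (real n))" using x by auto
        then have "y \<in> G n" unfolding G_def using \<open>y \<in> Q\<close> closure_subset[THEN subsetD] by (intro IntI)
        then show "y \<in> \<Union>(range G)" by blast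
      qed
    qed (auto simp: G_def)
    ultimately have "Q = {}" using interior_of_topspace[of "top_of_set Q"] by simp
    then show False using subspace_0[OF subQ] by auto
  qed
  then obtain n where "top_of_set Q interior_of G n \<noteq> {}" by blast
  then obtain y0 U where U: "openin (top_of_set Q) U" "U \<subseteq> G n" "y0 \<in> U"
    by (auto simp: interior_of_def)
  then obtain r where r: "r > 0" "ball y0 r \<inter> Q \<subseteq> U" unfolding openin_contains_ball by blast
  have y0: "y0 \<in> Q" using U by (auto simp: G_def)
  \<comment> \<open>Approximating \<open>y0 + y\<close> and \<open>y0\<close> separately and
    subtracting removes the unknown centre \<open>y0\<close>, at the price of doubling the radius
    \<open>n\<close>.\<close>
  have approx: "\<exists>x\<in>S. norm x \<le> 2 * real n \<and> norm (y - f x) < e"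
    if y: "y \<in> Q" "norm y < r" and e: "e > 0" for y e
  proof -
    have "y0 + y \<in> ball y0 r \<inter> Q" using y y0 subspace_add[OF subQ] by (simp add: dist_norm)
    then have "y0 + y \<in> G n" "y0 \<in> G n" using U r by blast+
    moreover have "\<exists>a\<in>S. norm a \<le> n \<and> dist (f a) z < e/2" if "z \<in> G n" for z
    proof -
      have "\<exists>u\<in>f ` (S \<inter> cball 0 (real n)). dist u z < e/2"
        using closure_approachable[THEN iffD1, THEN spec, THEN mp, OF _ half_gt_zero[OF e],
            of z "f ` (S \<inter> cball 0 (real n))"] that
        unfolding G_def by blast
      then show ?thesis by auto
    qed
    ultimately obtain a b where ab: "a \<in> S" "norm a \<le> n" "dist (f a) (y0 + y) < e/2"
        "b \<in> S" "norm b \<le> n" "dist (f b) y0 < e/2"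
      by blast
    have "norm (y - f (a - b)) \<le> norm (f a - (y0 + y)) + norm (f b - y0)"
      using norm_triangle_ineq4[of "f b - y0" "f a - (y0 + y)"] by (simp add: f.diff algebra_simps)
    then have "norm (y - f (a - b)) < e" using ab by (simp add: dist_norm)
    moreover have "norm (a - b) \<le> 2 * real n" using norm_triangle_ineq4[of a b] ab by linarith
    ultimately show ?thesis using ab subspace_diff[OF S(1)] by blast
  qed
  \<comment> \<open>Scaling a nonzero \<open>y\<close> to norm \<open>r / 2\<close> and solving up
    to \<open>r / 4\<close> leaves the relative error 1/2; undoing the scaling turns the bound
    \<open>2 * n\<close> into \<open>4 * n / r\<close> times \<open>norm y\<close>.\<close>
  define c where "c = 4 * real n / r"
  have c0: "c \<ge> 0" using r by (simp add: c_def)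
  have step: "\<exists>x\<in>S. norm x \<le> c * norm y \<and> norm (y - f x) \<le> 1/2 * norm y \<and> y - f x \<in> Q"
    if "y \<in> Q" for y
  proof (cases "y = 0")
    case True
    then show ?thesis using subspace_0[OF S(1)] subspace_0[OF subQ] by (intro bexI[of _ 0]) (auto simp: f.zero)
  next
    case False
    define t where "t = r / (2 * norm y)"
    have t: "t > 0" using r False by (simp add: t_def)
    have "norm (t *\<^sub>R y) < r" using r False t by (simp add: t_def)
    moreover have "t *\<^sub>R y \<in> Q" using that subspace_scale[OF subQ] by blast
    ultimately obtain x where x: "x \<in> S" "norm x \<le> 2 * real n" "norm (t *\<^sub>R y - f x) < r / 4"
      using approx[of "t *\<^sub>R y" "r/4"] r by auto
    have "y - f (x /\<^sub>R t) = (t *\<^sub>R y - f x) /\<^sub>R t"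
      using t by (simp add: f.scaleR scaleR_diff_right)
    then have "norm (y - f (x /\<^sub>R t)) = norm (t *\<^sub>R y - f x) / t" using t by (simp add: divide_inverse)
    also have "\<dots> \<le> (r/4) / t" using x t by (intro divide_right_mono) auto
    also have "\<dots> = 1/2 * norm y" using r False by (simp add: t_def)
    finally have 1: "norm (y - f (x /\<^sub>R t)) \<le> 1/2 * norm y" .
    have "norm (x /\<^sub>R t) = norm x / t" using t by (simp add: divide_inverse)
    also have "\<dots> \<le> (2 * real n) / t" using x t by (intro divide_right_mono) auto
    also have "\<dots> = c * norm y" using r False by (simp add: t_def c_def)
    finally have 2: "norm (x /\<^sub>R t) \<le> c * norm y" .
    have 3: "x /\<^sub>R t \<in> S" using x subspace_scale[OF S(1)] by blast
    then have "y - f (x /\<^sub>R t) \<in> Q" using that subspace_diff[OF subQ] by (auto simp: Q_def)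
    then show ?thesis using 1 2 3 by blast
  qed
  have *: "\<exists>x\<in>S. f x = y \<and> norm x \<le> c / (1 - 1/2) * norm y" if "y \<in> f ` S" for y
    using onto_from_approximation[OF f S c0, of "1/2" Q y] step that by (auto simp: Q_def)
  show thesis
  proof (rule that)
    \<comment> \<open>The iteration with \<open>q = 1/2\<close> gives the factor
      \<open>2 * c\<close>, which is 0 if \<open>n = 0\<close>; adding 1 makes the constant
      positive.\<close>
    show "2 * c + 1 > 0" using c0 by auto
    fix y assume "y \<in> f ` S"
    then obtain x where "x \<in> S" "f x = y" "norm x \<le> 2 * c * norm y" using * by fastforce
    moreover have "2 * c * norm y \<le> (2 * c + 1) * norm y" by (intro mult_right_mono) auto
    ultimately show "\<exists>x\<in>S. f x = y \<and> norm x \<le> (2 * c + 1) * norm y" by force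
  qed
qed

text \<open>A preimage under \<open>f\<close> is an approximate preimage under \<open>g\<close>: the
  error is the difference of \<open>g x\<close> and \<open>f x\<close>, at most \<open>c * e\<close>
  times the norm of the target, and it stays in \<open>Q\<close> because \<open>g\<close> maps
  \<open>S\<close> into \<open>Q\<close>.\<close>

lemma perturb_onto:
  fixes f g :: "'p::banach \<Rightarrow> 'q::real_normed_vector"
  assumes f: "bounded_linear f" and g: "bounded_linear g" and S: "subspace S" "closed S"
    and Q: "subspace Q" "g ` S \<subseteq> Q"
    and c: "0 \<le> c" "\<And>y. y \<in> Q \<Longrightarrow> \<exists>x\<in>S. f x = y \<and> norm x \<le> c * norm y"
    and e: "0 \<le> e" "\<And>x. x \<in> S \<Longrightarrow> norm (g x - f x) \<le> e * norm x" "c * e < 1"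
  shows "g ` S = Q"
proof
  show "Q \<subseteq> g ` S"
  proof
    fix y assume "y \<in> Q"
    have "\<exists>x\<in>S. g x = y \<and> norm x \<le> c / (1 - c * e) * norm y"
    proof (rule onto_from_approximation[OF g S])
      fix y assume y: "y \<in> Q"
      then obtain x where x: "x \<in> S" "f x = y" "norm x \<le> c * norm y" using c by blast
      have "norm (y - g x) \<le> e * norm x" using e(2)[OF x(1)] x(2) by (simp add: norm_minus_commute)
      also have "\<dots> \<le> e * (c * norm y)" using x e by (intro mult_left_mono)
      finally have "norm (y - g x) \<le> c * e * norm y" by (simp add: mult_ac)
      moreover have "y - g x \<in> Q" using Q x y by (auto intro: subspace_diff)
      ultimately show "\<exists>x\<in>S. norm x \<le> c * norm y \<and> norm (y - g x) \<le> c * e * norm y \<and> y - g x \<in> Q"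
        using x by blast
    qed (use c e \<open>y \<in> Q\<close> in auto)
    then show "y \<in> g ` S" by blast
  qed
qed (use Q in auto)

text \<open>On \<open>W \<times> L\<close> the map \<open>(w, l) \<mapsto> A w + l\<close> is
  injective with closed range, hence bounded below by the open mapping theorem. A small change of
  \<open>A\<close> keeps a lower bound, which gives injectivity and, for \<open>l = 0\<close>, the
  closed image of \<open>W\<close>. Surjectivity is kept by \<open>perturb_onto\<close>.\<close>

lemma perturb_direct_sum:
  fixes A :: "'x::banach \<Rightarrow> 'y::banach"
  assumes A: "bounded_linear A" and W: "subspace W" "closed W" and L: "subspace L" "closed L"
    and inj: "\<forall>w\<in>W. \<forall>l\<in>L. A w + l = 0 \<longrightarrow> w = 0 \<and> l = 0"
    and cl: "closed (A ` W + L)"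
  shows "\<exists>e>0. \<forall>B. bounded_linear B \<longrightarrow> (\<forall>x. norm (B x - A x) \<le> e * norm x) \<longrightarrow>
    (\<forall>w\<in>W. \<forall>l\<in>L. B w + l = 0 \<longrightarrow> w = 0 \<and> l = 0) \<and> closed (B ` W) \<and>
    (A ` W + L = UNIV \<longrightarrow> B ` W + L = UNIV)"
proof -
  define F where "F B = (\<lambda>p. B (fst p) + snd p)" for B :: "'x \<Rightarrow> 'y"
  have F: "bounded_linear (F B)" if "bounded_linear B" for B
    unfolding F_def
    by (intro bounded_linear_add bounded_linear_snd bounded_linear_compose[OF that bounded_linear_fst])
  have FS: "F B ` (W \<times> L) = B ` W + L" for B
    by (force simp: F_def set_plus_def image_iff)
  have S: "subspace (W \<times> L)" "closed (W \<times> L)"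
    using W L by (auto intro: subspace_Times closed_Times)
  interpret FA: bounded_linear "F A" using F[OF A] .
  obtain c where c: "c > 0" "\<And>y. y \<in> F A ` (W \<times> L) \<Longrightarrow> \<exists>p\<in>W \<times> L. F A p = y \<and> norm p \<le> c * norm y"
    using open_mapping_onto_closed[OF F[OF A] S] cl unfolding FS by blast
  \<comment> \<open>With \<open>c * e = 1/2\<close> the perturbation uses up half of the lower bound
    \<open>1 / c\<close>, and \<open>perturb_onto\<close> works with the contraction factor
    1/2.\<close>
  define e where "e = 1 / (2 * c)"
  have e: "e > 0" "c * e = 1/2" using c by (auto simp: e_def)
  have lowA: "norm p \<le> c * norm (F A p)" if p: "p \<in> W \<times> L" for p
  proof -
    \<comment> \<open>The open mapping theorem bounds only some preimage of \<open>F A p\<close>;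
      injectivity shows that this preimage is \<open>p\<close> itself.\<close>
    obtain p' where p': "p' \<in> W \<times> L" "F A p' = F A p" "norm p' \<le> c * norm (F A p)" using c p by blast
    have "F A (p - p') = 0" using p' by (simp add: FA.diff)
    moreover have "p - p' \<in> W \<times> L" using p p' S subspace_diff by blast
    ultimately have "p - p' = 0"
      using inj[rule_format, of "fst (p - p')" "snd (p - p')"] by (auto simp: F_def mem_Times_iff prod_eq_iff)
    then show ?thesis using p' by simp
  qed
  have diffB: "norm (F B p - F A p) \<le> e * norm p" if "\<And>x. norm (B x - A x) \<le> e * norm x" for B p
  proof -
    have "norm (F B p - F A p) \<le> e * norm (fst p)" using that[of "fst p"] by (simp add: F_def)
    also have "\<dots> \<le> e * norm p" using e norm_fst_le[of "fst p" "snd p"] by (intro mult_left_mono) auto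
    finally show ?thesis .
  qed
  have lowB: "norm p \<le> 2 * c * norm (F B p)"
    if p: "p \<in> W \<times> L" and B: "\<And>x. norm (B x - A x) \<le> e * norm x" for p B
  proof -
    have "norm (F A p) \<le> norm (F B p) + e * norm p"
      using diffB[OF B, of p] norm_triangle_ineq2[of "F A p" "F B p"] by (simp add: norm_minus_commute)
    then have "c * norm (F A p) \<le> c * (norm (F B p) + e * norm p)" using c by (intro mult_left_mono) auto
    also have "\<dots> = c * norm (F B p) + (c * e) * norm p" by (simp add: algebra_simps)
    finally show ?thesis using lowA[OF p] unfolding e(2) by simp
  qed
  show ?thesis
  proof (intro exI[of _ e] conjI e(1) allI impI)
    fix B :: "'x \<Rightarrow> 'y" assume B: "bounded_linear B" and "\<forall>x. norm (B x - A x) \<le> e * norm x"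
    then have near: "\<And>x. norm (B x - A x) \<le> e * norm x" by blast
    show "\<forall>w\<in>W. \<forall>l\<in>L. B w + l = 0 \<longrightarrow> w = 0 \<and> l = 0"
    proof (intro ballI impI)
      fix w l assume "w \<in> W" "l \<in> L" "B w + l = 0"
      then show "w = 0 \<and> l = 0" using lowB[OF _ near, of "(w, l)"] by (simp add: F_def prod_eq_iff)
    qed
    show "closed (B ` W)"
    proof -
      have "complete (B ` W)"
      proof (rule complete_isometric_image)
        show "0 < 1 / (2 * c)" using c by simp
        show "\<forall>x\<in>W. 1 / (2 * c) * norm x \<le> norm (B x)"
        proof
          fix x assume "x \<in> W"
          then have "norm x \<le> 2 * c * norm (B x)"
            using lowB[OF _ near, of "(x, 0)"] subspace_0[OF L(1)] by (simp add: F_def norm_Pair)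
          then show "1 / (2 * c) * norm x \<le> norm (B x)" using c by (simp add: field_simps)
        qed
      qed (use W B in \<open>simp_all add: complete_eq_closed\<close>)
      then show ?thesis by (simp add: complete_eq_closed)
    qed
    show "B ` W + L = UNIV" if "A ` W + L = UNIV"
    proof -
      have "F B ` (W \<times> L) = UNIV"
        by (rule perturb_onto[OF F[OF A] F[OF B] S, of UNIV c e])
          (use c e diffB[OF near] that FS in auto)
      then show ?thesis by (simp add: FS)
    qed
  qed
qed

text \<open>By the open mapping theorem for \<open>(a, l) \<mapsto> A a + l\<close>, the component
  along \<open>L\<close> depends continuously on the vector. It vanishes on the range, hence also on
  limits of the range.\<close>

lemma closed_range_if_closed_complement:
  fixes A :: "'x::banach \<Rightarrow> 'y::banach"
  assumes A: "bounded_linear A" and L: "subspace L" "closed L"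
    and int: "range A \<inter> L = {0}" and sum: "range A + L = UNIV"
  shows "closed (range A)"
proof -
  interpret A: bounded_linear A by fact
  define F where "F = (\<lambda>p. A (fst p) + snd p)"
  have F: "bounded_linear F"
    unfolding F_def
    by (intro bounded_linear_add bounded_linear_snd bounded_linear_compose[OF A bounded_linear_fst])
  have FS: "F ` (UNIV \<times> L) = UNIV"
    unfolding sum[symmetric] by (force simp: F_def set_plus_def image_iff)
  have S: "subspace (UNIV \<times> L)" "closed (UNIV \<times> L :: ('x \<times> 'y) set)"
    using L by (auto intro: subspace_Times closed_Times)
  obtain c where c: "c > 0" "\<And>y. \<exists>p\<in>UNIV \<times> L. F p = y \<and> norm p \<le> c * norm y"
    using open_mapping_onto_closed[OF F S] unfolding FS by (metis UNIV_I closed_UNIV)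
  have R: "subspace (range A)" by (rule linear_subspace_image[OF bounded_linear.linear[OF A] subspace_UNIV])
  show ?thesis
    unfolding closed_sequential_limits
  proof (intro allI impI, elim conjE)
    fix s x assume s: "\<forall>n. s n \<in> range A" "s \<longlonglongrightarrow> x"
    obtain a l where x: "x = A a + l" "l \<in> L"
    proof -
      have "x \<in> range A + L" using sum by simp
      then show thesis using that by (auto elim!: set_plus_elim)
    qed
    \<comment> \<open>Subtracting \<open>s n\<close> from \<open>x\<close> does not change the
      component \<open>l\<close>. By uniqueness of the decomposition, the second entry of a small
      preimage of \<open>x - s n\<close> is therefore \<open>l\<close>.\<close>
    have le: "norm l \<le> c * norm (x - s n)" for n
    proof -
      obtain p where p: "p \<in> UNIV \<times> L" "F p = x - s n" "norm p \<le> c * norm (x - s n)" using c by blast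
      have "A a - s n - A (fst p) = snd p - l" using p(2) x by (simp add: F_def algebra_simps)
      moreover have "A a - s n - A (fst p) \<in> range A" using s R by (intro subspace_diff) auto
      moreover have "snd p - l \<in> L" using x p L by (auto intro: subspace_diff)
      ultimately have "snd p - l \<in> range A \<inter> L" by simp
      then have "snd p - l = 0" unfolding int by simp
      then have "l = snd p" by simp
      then have "norm l \<le> norm p" using norm_snd_le[of "snd p" "fst p"] by simp
      then show ?thesis using p(3) by (rule order_trans)
    qed
    have "(\<lambda>n. c * norm (x - s n)) \<longlonglongrightarrow> c * norm (x - x)" by (intro tendsto_intros s)
    then have "norm l \<le> c * norm (x - x)" by (rule LIMSEQ_le_const) (use le in blast)
    then show "x \<in> range A" using x by auto
  qed
qed

section \<open>Finite-dimensional and finite-codimensional complex subspaces\<close>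

lemma csubspace_imp_subspace: "csubspace M \<Longrightarrow> subspace M"
  by (auto simp: complex_vector.subspace_def subspace_def scaleR_scaleC)

lemma csubspace_plus: "csubspace M \<Longrightarrow> csubspace L \<Longrightarrow> csubspace (M + L)"
  using complex_vector.subspace_sums[of M L]
  by (rule back_subst[where P = csubspace]) (auto simp: set_plus_def)

lemma subset_plus_left:
  fixes L :: "'a::monoid_add set"
  assumes "0 \<in> L"
  shows "M \<subseteq> M + L"
proof
  fix x assume "x \<in> M"
  from set_plus_intro[OF this assms] show "x \<in> M + L" by simp
qed

lemma subset_plus_right:
  fixes L :: "'a::monoid_add set"
  assumes "0 \<in> M"
  shows "L \<subseteq> M + L"
proof
  fix x assume "x \<in> L"
  from set_plus_intro[OF assms this] show "x \<in> M + L" by simp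
qed

lemma plus_subset_csubspace: "M \<subseteq> V \<Longrightarrow> L \<subseteq> V \<Longrightarrow> csubspace V \<Longrightarrow> M + L \<subseteq> V"
  by (auto elim!: set_plus_elim intro: complex_vector.subspace_add)

text \<open>Adding a generator amounts to adding a line to the sum reached so far; the inductions
  over finite spanning sets use it in this form.\<close>

lemma plus_cspan_insert:
  "L + cspan (insert b B) = {x. \<exists>k. x - k *\<^sub>C b \<in> L + cspan B}"
proof (intro set_eqI iffI)
  fix x assume "x \<in> L + cspan (insert b B)"
  then obtain l s k where "l \<in> L" "x = l + s" "s - k *\<^sub>C b \<in> cspan B"
    unfolding complex_vector.span_insert by (auto elim!: set_plus_elim)
  then have "l + (s - k *\<^sub>C b) \<in> L + cspan B" "x - k *\<^sub>C b = l + (s - k *\<^sub>C b)" by (auto intro: set_plus_intro)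
  then show "x \<in> {x. \<exists>k. x - k *\<^sub>C b \<in> L + cspan B}" by (metis mem_Collect_eq)
next
  fix x assume "x \<in> {x. \<exists>k. x - k *\<^sub>C b \<in> L + cspan B}"
  then obtain k l s where "l \<in> L" "s \<in> cspan B" "x - k *\<^sub>C b = l + s" by (auto elim!: set_plus_elim)
  then have "x = l + (s + k *\<^sub>C b)" "s + k *\<^sub>C b \<in> cspan (insert b B)"
    unfolding complex_vector.span_insert by (auto simp: algebra_simps intro!: exI[of _ k])
  then show "x \<in> L + cspan (insert b B)" using \<open>l \<in> L\<close> by (auto intro: set_plus_intro)
qed

text \<open>A vector \<open>b\<close> outside \<open>L\<close> has positive distance from
  \<open>L\<close>, so the norm of a sum controls its coefficient of \<open>b\<close>. Along a
  convergent sequence these coefficients are then Cauchy.\<close>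

lemma closed_plus_line:
  fixes L :: "'a::complex_normed_vector set"
  assumes L: "csubspace L" "closed L"
  shows "closed {x. \<exists>k. x - k *\<^sub>C b \<in> L}"
proof (cases "b \<in> L")
  case True
  have "{x. \<exists>k. x - k *\<^sub>C b \<in> L} = L"
  proof (intro set_eqI iffI)
    fix x assume "x \<in> {x. \<exists>k. x - k *\<^sub>C b \<in> L}"
    then obtain k where "x - k *\<^sub>C b \<in> L" by blast
    then have "(x - k *\<^sub>C b) + k *\<^sub>C b \<in> L"
      by (intro complex_vector.subspace_add complex_vector.subspace_scale L True)
    then show "x \<in> L" by simp
  next
    fix x assume "x \<in> L"
    then have "x - 0 *\<^sub>C b \<in> L" by simp
    then show "x \<in> {x. \<exists>k. x - k *\<^sub>C b \<in> L}" by blast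
  qed
  then show ?thesis using L by simp
next
  case False
  then obtain d where d: "d > 0" "ball b d \<subseteq> - L"
    using L(2) open_contains_ball[of "- L"] by (auto simp: open_Compl)
  have low: "cmod k * d \<le> norm (y + k *\<^sub>C b)" if y: "y \<in> L" for y k
  proof (cases "k = 0")
    case False
    \<comment> \<open>Dividing by \<open>k\<close> turns \<open>y + k *\<^sub>C b\<close> into
      \<open>b\<close> minus an element of \<open>L\<close>, whose norm is at least
      \<open>d\<close>.\<close>
    have "(- inverse k) *\<^sub>C y \<in> L" using y L by (intro complex_vector.subspace_scale)
    then have "d \<le> norm (b + inverse k *\<^sub>C y)"
      using d(2) by (fastforce simp: dist_norm subset_eq not_less)
    also have "b + inverse k *\<^sub>C y = inverse k *\<^sub>C (y + k *\<^sub>C b)"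
      using False by (simp add: scaleC_add_right scaleC_scaleC scaleC_one add.commute)
    finally have "d \<le> inverse (cmod k) * norm (y + k *\<^sub>C b)" by (simp add: norm_scaleC norm_inverse)
    then show ?thesis using False by (simp add: field_simps)
  qed simp
  show ?thesis
    unfolding closed_sequential_limits
  proof (intro allI impI, elim conjE)
    fix s x assume s: "\<forall>n. s n \<in> {x. \<exists>k. x - k *\<^sub>C b \<in> L}" "s \<longlonglongrightarrow> x"
    then obtain k where k: "\<And>n. s n - k n *\<^sub>C b \<in> L" by (auto simp: choice_iff)
    have le: "cmod (k m - k n) * d \<le> norm (s m - s n)" for m n
    proof -
      have "(s m - k m *\<^sub>C b) - (s n - k n *\<^sub>C b) \<in> L" by (rule complex_vector.subspace_diff[OF L(1) k k])
      from low[OF this, of "k m - k n"] show ?thesis by (simp add: complex_vector.scale_left_diff_distrib)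
    qed
    have "Cauchy k"
    proof (rule CauchyI)
      fix e :: real assume "e > 0"
      have "Cauchy s" using s(2) by (rule LIMSEQ_imp_Cauchy)
      then obtain M where M: "\<And>m n. m \<ge> M \<Longrightarrow> n \<ge> M \<Longrightarrow> norm (s m - s n) < e * d"
        using CauchyD[of s "e * d"] \<open>e > 0\<close> d by auto
      have "norm (k m - k n) < e" if "m \<ge> M" "n \<ge> M" for m n
      proof -
        have "cmod (k m - k n) * d < e * d" using le[of m n] M[OF that] by linarith
        then show ?thesis using d by simp
      qed
      then show "\<exists>M. \<forall>m\<ge>M. \<forall>n\<ge>M. norm (k m - k n) < e" by blast
    qed
    then obtain c where c: "k \<longlonglongrightarrow> c" using Cauchy_convergent convergentD by blast
    have "bounded_linear (\<lambda>c. c *\<^sub>C b)"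
      by (rule bounded_linear_intro[of _ "norm b"])
        (auto simp: scaleC_add_left norm_scaleC scaleR_scaleC scaleC_scaleC scaleR_conv_of_real)
    then have "(\<lambda>n. k n *\<^sub>C b) \<longlonglongrightarrow> c *\<^sub>C b" using c by (rule bounded_linear.tendsto)
    then have "(\<lambda>n. s n - k n *\<^sub>C b) \<longlonglongrightarrow> x - c *\<^sub>C b" by (intro tendsto_diff s)
    then have "x - c *\<^sub>C b \<in> L" by (rule closed_sequentially[OF L(2) k])
    then show "x \<in> {x. \<exists>k. x - k *\<^sub>C b \<in> L}" by blast
  qed
qed

lemma closed_plus_cspan:
  fixes L :: "'a::complex_normed_vector set"
  assumes "finite B" and L: "csubspace L" "closed L"
  shows "closed (L + cspan B)"
  using \<open>finite B\<close>
proof (induction B rule: finite_induct)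
  case empty
  have "L + cspan {} = L" by (auto simp: set_plus_def)
  then show ?case using L by simp
next
  case (insert b B)
  then show ?case
    unfolding plus_cspan_insert by (intro closed_plus_line csubspace_plus L complex_vector.subspace_span)
qed

lemma closed_cspan: "finite B \<Longrightarrow> closed (cspan B :: 'a::complex_normed_vector set)"
proof -
  assume "finite B"
  moreover have "{0} + cspan B = cspan B" by (auto simp: set_plus_def)
  ultimately show ?thesis using closed_plus_cspan[of B "{0}"] complex_vector.subspace_single_0 by simp
qed

text \<open>Generators are kept greedily: \<open>b\<close> is added only if it lies outside the sum
  reached so far, and then the intersection with \<open>U\<close> stays trivial.\<close>

lemma direct_sum_cspan:
  assumes "finite B" and U: "csubspace U"
  shows "\<exists>B'\<subseteq>B. U \<inter> cspan B' = {0} \<and> U + cspan B' = U + cspan B"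
  using \<open>finite B\<close>
proof (induction B rule: finite_induct)
  case empty
  then show ?case using complex_vector.subspace_0[OF U] by auto
next
  case (insert b B)
  then obtain B' where B': "B' \<subseteq> B" "U \<inter> cspan B' = {0}" "U + cspan B' = U + cspan B" by blast
  have sub: "csubspace (U + cspan B')" by (intro csubspace_plus U complex_vector.subspace_span)
  show ?case
  proof (cases "b \<in> U + cspan B'")
    case True
    have "U + cspan (insert b B) = U + cspan B'"
      unfolding plus_cspan_insert B'(3)[symmetric]
    proof (intro set_eqI iffI)
      fix x assume "x \<in> {x. \<exists>k. x - k *\<^sub>C b \<in> U + cspan B'}"
      then obtain k where "x - k *\<^sub>C b \<in> U + cspan B'" by blast
      then have "(x - k *\<^sub>C b) + k *\<^sub>C b \<in> U + cspan B'"
        by (intro complex_vector.subspace_add complex_vector.subspace_scale sub True)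
      then show "x \<in> U + cspan B'" by simp
    next
      fix x assume "x \<in> U + cspan B'"
      then have "x - 0 *\<^sub>C b \<in> U + cspan B'" by simp
      then show "x \<in> {x. \<exists>k. x - k *\<^sub>C b \<in> U + cspan B'}" by blast
    qed
    then show ?thesis using B' by blast
  next
    case False
    have "U \<inter> cspan (insert b B') \<subseteq> {0}"
    proof
      fix u assume "u \<in> U \<inter> cspan (insert b B')"
      then obtain k where u: "u \<in> U" "u - k *\<^sub>C b \<in> cspan B'" by (auto simp: complex_vector.span_insert)
      show "u \<in> {0}"
      proof (cases "k = 0")
        case True
        then show ?thesis using u B'(2) by auto
      next
        case k: False
        have "u + (- (u - k *\<^sub>C b)) \<in> U + cspan B'"
          using u by (intro set_plus_intro complex_vector.span_neg)
        then have "k *\<^sub>C b \<in> U + cspan B'" by simp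
        then have "inverse k *\<^sub>C k *\<^sub>C b \<in> U + cspan B'" by (rule complex_vector.subspace_scale[OF sub])
        then show ?thesis using False k by (simp add: scaleC_scaleC scaleC_one)
      qed
    qed
    moreover have "0 \<in> U \<inter> cspan (insert b B')"
      using complex_vector.subspace_0[OF U] complex_vector.span_zero by blast
    moreover have "U + cspan (insert b B') = U + cspan (insert b B)"
      unfolding plus_cspan_insert B'(3) ..
    ultimately show ?thesis using B'(1) by (intro exI[of _ "insert b B'"]) auto
  qed
qed

lemma finite_cdim_subspace:
  assumes M: "csubspace M" "M \<subseteq> cspan B" and "finite B"
  shows "finite_cdim M"
proof -
  obtain C where C: "C \<subseteq> M" "complex_vector.independent C" "M \<subseteq> cspan C"
    using complex_vector.maximal_independent_subset .
  have "finite C" using complex_vector.independent_span_bound[OF \<open>finite B\<close> C(2)] C(1) M(2) by blast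
  moreover have "M = cspan C" using C complex_vector.span_minimal[OF C(1) M(1)] by blast
  ultimately show ?thesis unfolding finite_cdim_def by blast
qed

lemma finite_ccodim_iff: "finite_ccodim M \<longleftrightarrow> (\<exists>B. finite B \<and> M + cspan B = UNIV)"
proof -
  have "(\<forall>x. \<exists>b\<in>cspan B. x - b \<in> M) \<longleftrightarrow> M + cspan B = UNIV" for B
  proof
    assume *: "\<forall>x. \<exists>b\<in>cspan B. x - b \<in> M"
    show "M + cspan B = UNIV"
    proof (intro set_eqI iffI UNIV_I)
      fix x
      obtain b where "b \<in> cspan B" "x - b \<in> M" using * by blast
      then have "(x - b) + b \<in> M + cspan B" by (intro set_plus_intro)
      then show "x \<in> M + cspan B" by simp
    qed
  next
    assume *: "M + cspan B = UNIV"
    show "\<forall>x. \<exists>b\<in>cspan B. x - b \<in> M"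
    proof
      fix x
      have "x \<in> M + cspan B" using * by simp
      then obtain m b where "x = m + b" "m \<in> M" "b \<in> cspan B" by (rule set_plus_elim)
      then show "\<exists>b\<in>cspan B. x - b \<in> M" by (intro bexI[of _ b]) auto
    qed
  qed
  then show ?thesis unfolding finite_ccodim_def by simp
qed

text \<open>The sets \<open>R k \<inter> cspan B\<close> lie in one finite-dimensional space, so
  their dimension reaches a minimum and they are constant from there on. Each \<open>R k\<close>
  with \<open>k \<ge> 1\<close> contains \<open>M\<close>, and \<open>M + cspan B\<close> is
  everything, so by the modular law \<open>R k\<close> is determined by this intersection.\<close>

lemma descending_chain_stabilizes:
  fixes R :: "nat \<Rightarrow> 'a::complex_vector set"
  assumes R: "\<And>k. csubspace (R k)" and anti: "\<And>j k. j \<le> k \<Longrightarrow> R k \<subseteq> R j"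
    and codim: "finite_ccodim (\<Inter>k\<in>{1..}. R k)"
  shows "\<exists>k\<ge>1. \<forall>j\<ge>k. R j = (\<Inter>k\<in>{1..}. R k)"
proof -
  define M where "M = (\<Inter>k\<in>{1..}. R k)"
  obtain B where B: "finite B" "M + cspan B = UNIV" using codim unfolding finite_ccodim_iff M_def by blast
  \<comment> \<open>\<open>P n\<close> says that \<open>n\<close> is the dimension of
    \<open>R k \<inter> cspan B\<close> for some \<open>k \<ge> 1\<close>; the least such
    \<open>n\<close> is the stable dimension.\<close>
  define P where "P n \<longleftrightarrow> (\<exists>k\<ge>1. \<exists>C. complex_vector.independent C \<and> C \<subseteq> R k \<inter> cspan B \<and>
    R k \<inter> cspan B \<subseteq> cspan C \<and> card C = n)" for n
  have basis: "\<exists>C. complex_vector.independent C \<and> C \<subseteq> R k \<inter> cspan B \<and> R k \<inter> cspan B \<subseteq> cspan C" for k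
    by (rule complex_vector.maximal_independent_subset[of "R k \<inter> cspan B"]) (intro exI conjI)
  have fin: "finite C" if "complex_vector.independent C" "C \<subseteq> R k \<inter> cspan B" for C k
    using complex_vector.independent_span_bound[OF B(1) that(1)] that(2) by blast
  have "\<exists>n. P n" using basis[of 1] unfolding P_def by blast
  then have "P (LEAST n. P n)" by (rule LeastI_ex)
  then obtain k C where k: "k \<ge> 1" and C: "complex_vector.independent C" "C \<subseteq> R k \<inter> cspan B"
      "R k \<inter> cspan B \<subseteq> cspan C" "card C = (LEAST n. P n)"
    unfolding P_def by blast
  have sub: "R k \<inter> cspan B \<subseteq> R j" if "j \<ge> k" for j
  proof -
    obtain D where D: "complex_vector.independent D" "D \<subseteq> R j \<inter> cspan B" "R j \<inter> cspan B \<subseteq> cspan D"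
      using basis[of j] by (elim exE conjE)
    have "P (card D)" unfolding P_def using D that k by (intro exI[of _ j] exI[of _ D] conjI) auto
    then have le: "card C \<le> card D" unfolding C(4) by (rule Least_le)
    have DC: "D \<subseteq> cspan C" using D(2) C(3) anti[OF that] by blast
    \<comment> \<open>Otherwise adjoining some \<open>c\<close> to \<open>D\<close> would give an
      independent subset of \<open>cspan C\<close> with more than \<open>card C\<close>
      elements.\<close>
    have "C \<subseteq> cspan D"
    proof (rule ccontr)
      assume "\<not> C \<subseteq> cspan D"
      then obtain c where c: "c \<in> C" "c \<notin> cspan D" by blast
      then have "complex_vector.independent (insert c D)" using D(1) by (intro complex_vector.independent_insertI)
      moreover have "insert c D \<subseteq> cspan C" using DC c complex_vector.span_base by blast
      ultimately have "card (insert c D) \<le> card C"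
        using complex_vector.independent_span_bound[OF fin[OF C(1,2)]] by blast
      moreover have "c \<notin> D" using c complex_vector.span_base by blast
      ultimately show False using le fin[OF D(1,2)] by simp
    qed
    moreover have "cspan D \<subseteq> R j" using D(2) by (intro complex_vector.span_minimal R) blast
    ultimately have "cspan C \<subseteq> R j" by (intro complex_vector.span_minimal R) blast
    then show ?thesis using C(3) by blast
  qed
  have MR: "M \<subseteq> R j" if "j \<ge> 1" for j using that by (auto simp: M_def)
  have "R k \<inter> cspan B \<subseteq> M"
    unfolding M_def
  proof (intro INT_greatest)
    fix j assume "j \<in> {1::nat..}"
    have "R k \<inter> cspan B \<subseteq> R (max j k)" by (rule sub) simp
    also have "\<dots> \<subseteq> R j" by (rule anti) simp
    finally show "R k \<inter> cspan B \<subseteq> R j" .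
  qed
  have "R k \<subseteq> M"
  proof
    fix x assume x: "x \<in> R k"
    have "x \<in> M + cspan B" using B by simp
    then obtain m b where mb: "x = m + b" "m \<in> M" "b \<in> cspan B" by (rule set_plus_elim)
    have "x - m \<in> R k" using x mb MR[OF k] R by (intro complex_vector.subspace_diff) auto
    then have "b \<in> M" using mb \<open>R k \<inter> cspan B \<subseteq> M\<close> by auto
    moreover have "csubspace M" unfolding M_def by (intro complex_vector.subspace_Inter) (auto intro: R)
    ultimately show "x \<in> M" using mb complex_vector.subspace_add by blast
  qed
  then have "R j = M" if "j \<ge> k" for j using MR[of j] anti[OF that] that k by auto
  then show ?thesis using k unfolding M_def by blast
qed

section \<open>Complements of finite-dimensional subspaces\<close>

text \<open>Zorn's lemma is applied to the graphs of partial functionals, as subspaces of the product with the reals.\<close>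

lemma hahn_banach_norming:
  fixes b :: "'a::real_normed_vector"
  obtains \<phi> :: "'a \<Rightarrow> real" where "linear \<phi>" "\<And>x. \<phi> x \<le> norm x" "\<phi> b = norm b"
proof -
  define \<A> where "\<A> = {G :: ('a \<times> real) set. subspace G \<and> (b, norm b) \<in> G \<and> (\<forall>x t. (x, t) \<in> G \<longrightarrow> t \<le> norm x)}"
  have "\<exists>M\<in>\<A>. \<forall>X\<in>\<A>. M \<subseteq> X \<longrightarrow> X = M"
  proof (rule subset_Zorn_nonempty)
    have "span {(b, norm b)} \<in> \<A>"
      unfolding \<A>_def
    proof (intro CollectI conjI allI impI)
      fix x t assume "(x, t) \<in> span {(b, norm b)}"
      then obtain k where "x = k *\<^sub>R b" "t = k * norm b" by (auto simp: span_singleton)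
      then show "t \<le> norm x" by (simp add: mult_right_mono)
    qed (auto simp: subspace_span span_base)
    then show "\<A> \<noteq> {}" by blast
  next
    fix \<C> assume ne: "\<C> \<noteq> {}" and ch: "subset.chain \<A> \<C>"
    have CA: "G \<in> \<A>" if "G \<in> \<C>" for G using ch that by (auto simp: subset.chain_def)
    have sub: "subspace G" if "G \<in> \<C>" for G using CA[OF that] by (simp add: \<A>_def)
    have "subspace (\<Union>\<C>)"
      unfolding subspace_def
    proof (intro conjI ballI allI)
      show "0 \<in> \<Union>\<C>" using ne sub subspace_0 by blast
    next
      fix p q assume "p \<in> \<Union>\<C>" "q \<in> \<Union>\<C>"
      then obtain G H where GH: "G \<in> \<C>" "H \<in> \<C>" "p \<in> G" "q \<in> H" by blast
      then have "G \<subseteq> H \<or> H \<subseteq> G" using ch by (auto simp: subset.chain_def)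
      then show "p + q \<in> \<Union>\<C>" using GH sub subspace_add by blast
    next
      fix c :: real and p assume "p \<in> \<Union>\<C>"
      then show "c *\<^sub>R p \<in> \<Union>\<C>" using sub subspace_scale by blast
    qed
    moreover have "(b, norm b) \<in> \<Union>\<C>" using ne CA by (auto simp: \<A>_def)
    moreover have "\<forall>x t. (x, t) \<in> \<Union>\<C> \<longrightarrow> t \<le> norm x" using CA by (auto simp: \<A>_def)
    ultimately show "\<Union>\<C> \<in> \<A>" by (simp add: \<A>_def)
  qed
  then obtain M where M: "M \<in> \<A>" and max: "\<And>X. X \<in> \<A> \<Longrightarrow> M \<subseteq> X \<Longrightarrow> X = M" by blast
  have subM: "subspace M" and bM: "(b, norm b) \<in> M" and leM: "\<And>x t. (x, t) \<in> M \<Longrightarrow> t \<le> norm x"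
    using M by (auto simp: \<A>_def)
  have addM: "(x + y, s + t) \<in> M" if "(x, s) \<in> M" "(y, t) \<in> M" for x y s t
    using subspace_add[OF subM that] by simp
  have scaleM: "(k *\<^sub>R x, k * s) \<in> M" if "(x, s) \<in> M" for k x s
    using subspace_scale[OF subM that, of k] by simp
  have dom: "\<exists>t. (x0, t) \<in> M" for x0
  proof -
    \<comment> \<open>\<open>V\<close> consists of the lower bounds that domination by the norm
      imposes on a value at \<open>x0\<close>. By \<open>key\<close> each of them is below every
      upper bound, so \<open>Sup V\<close> is an admissible value.\<close>
    define V where "V = {s - norm (y - x0) | y s. (y, s) \<in> M}"
    have key: "s - norm (y - x0) \<le> norm (z + x0) - t" if "(y, s) \<in> M" "(z, t) \<in> M" for y s z t
    proof -
      have "s + t \<le> norm (y + z)" using addM[OF that] by (rule leM)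
      also have "\<dots> \<le> norm (y - x0) + norm (z + x0)" using norm_triangle_ineq[of "y - x0" "z + x0"] by simp
      finally show ?thesis by simp
    qed
    have bdd: "bdd_above V"
      unfolding V_def bdd_above_def using key[OF _ bM] by (intro exI[of _ "norm (b + x0) - norm b"]) blast
    define c where "c = Sup V"
    have lo: "s - norm (y - x0) \<le> c" if "(y, s) \<in> M" for y s
      unfolding c_def by (rule cSup_upper[OF _ bdd]) (use that in \<open>auto simp: V_def\<close>)
    have hi: "c \<le> norm (z + x0) - t" if "(z, t) \<in> M" for z t
      unfolding c_def
    proof (rule cSup_least)
      show "V \<noteq> {}" using bM by (auto simp: V_def)
      fix v assume "v \<in> V"
      then show "v \<le> norm (z + x0) - t" using key[OF _ that] by (auto simp: V_def)
    qed
    define G where "G = {(y + k *\<^sub>R x0, s + k * c) | y s k. (y, s) \<in> M}"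
    have "t \<le> norm x" if xt: "(x, t) \<in> G" for x t
    proof -
      obtain y s k where x: "x = y + k *\<^sub>R x0" "t = s + k * c" "(y, s) \<in> M" using xt by (auto simp: G_def)
      \<comment> \<open>After division by the modulus of \<open>k\<close>, the case
        \<open>k > 0\<close> is the upper bound \<open>hi\<close> and the case \<open>k < 0\<close>
        the lower bound \<open>lo\<close>.\<close>
      consider "k = 0" | "k > 0" | "k < 0" by linarith
      then show ?thesis
      proof cases
        case 1
        then show ?thesis using x leM by simp
      next
        case 2
        have "c \<le> norm (inverse k *\<^sub>R y + x0) - inverse k * s" by (intro hi scaleM x)
        then have "k * c \<le> k * (norm (inverse k *\<^sub>R y + x0) - inverse k * s)"
          using 2 by (intro mult_left_mono) auto
        also have "\<dots> = norm (k *\<^sub>R (inverse k *\<^sub>R y + x0)) - s"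
          using 2 by (simp add: right_diff_distrib)
        also have "k *\<^sub>R (inverse k *\<^sub>R y + x0) = x" using 2 x by (simp add: scaleR_add_right)
        finally show ?thesis using x by simp
      next
        case 3
        define m where "m = - k"
        have m: "m > 0" using 3 by (simp add: m_def)
        have "inverse m * s - norm (inverse m *\<^sub>R y - x0) \<le> c" by (intro lo scaleM x)
        then have "m * (inverse m * s - norm (inverse m *\<^sub>R y - x0)) \<le> m * c"
          using m by (intro mult_left_mono) auto
        also have "m * (inverse m * s - norm (inverse m *\<^sub>R y - x0)) = s - norm (m *\<^sub>R (inverse m *\<^sub>R y - x0))"
          using m by (simp add: right_diff_distrib)
        also have "m *\<^sub>R (inverse m *\<^sub>R y - x0) = x" using m x by (simp add: scaleR_diff_right m_def)
        finally show ?thesis using x by (simp add: m_def)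
      qed
    qed
    moreover have "subspace G"
      unfolding subspace_def
    proof (intro conjI ballI allI)
      have "(0 + 0 *\<^sub>R x0, 0 + 0 * c) \<in> G"
        using subspace_0[OF subM] unfolding G_def zero_prod_def by blast
      then show "0 \<in> G" by (simp add: zero_prod_def)
    next
      fix p q assume "p \<in> G" "q \<in> G"
      then obtain y s k z t l where p: "p = (y + k *\<^sub>R x0, s + k * c)" "(y, s) \<in> M"
          and q: "q = (z + l *\<^sub>R x0, t + l * c)" "(z, t) \<in> M" unfolding G_def by blast
      have "p + q = ((y + z) + (k + l) *\<^sub>R x0, (s + t) + (k + l) * c)"
        unfolding p q by (simp add: algebra_simps)
      then show "p + q \<in> G" using addM[OF p(2) q(2)] unfolding G_def by blast
    next
      fix a :: real and p assume "p \<in> G"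
      then obtain y s k where p: "p = (y + k *\<^sub>R x0, s + k * c)" "(y, s) \<in> M" unfolding G_def by blast
      have "a *\<^sub>R p = (a *\<^sub>R y + (a * k) *\<^sub>R x0, a * s + (a * k) * c)"
        unfolding p by (simp add: algebra_simps)
      then show "a *\<^sub>R p \<in> G" using scaleM[OF p(2)] unfolding G_def by blast
    qed
    moreover have "M \<subseteq> G"
    proof
      fix p assume "p \<in> M"
      then have "(fst p + 0 *\<^sub>R x0, snd p + 0 * c) \<in> G" unfolding G_def by fastforce
      then show "p \<in> G" by simp
    qed
    ultimately have "G = M" using bM by (intro max) (auto simp: \<A>_def)
    have "(0 + 1 *\<^sub>R x0, 0 + 1 * c) \<in> G"
      using subspace_0[OF subM] unfolding G_def zero_prod_def by blast
    then show ?thesis using \<open>G = M\<close> by auto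
  qed
  \<comment> \<open>Over the point 0 the graph contains only the value 0, because domination by
    \<open>norm 0\<close> applies to a value and to its negative.\<close>
  have uniq: "s = t" if "(x, s) \<in> M" "(x, t) \<in> M" for x s t
  proof -
    have "(0, s - t) \<in> M" "(0, t - s) \<in> M"
      using subspace_diff[OF subM that] subspace_diff[OF subM that(2,1)] by simp_all
    then show ?thesis using leM[of 0 "s - t"] leM[of 0 "t - s"] by simp
  qed
  obtain \<phi> where \<phi>: "\<And>x. (x, \<phi> x) \<in> M" using dom by metis
  show thesis
  proof (rule that)
    show "linear \<phi>"
    proof (rule linearI)
      show "\<phi> (x + y) = \<phi> x + \<phi> y" for x y by (rule uniq[OF \<phi> addM[OF \<phi> \<phi>]])
      show "\<phi> (k *\<^sub>R x) = k *\<^sub>R \<phi> x" for k x using uniq[OF \<phi> scaleM[OF \<phi>]] by simp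
    qed
    show "\<phi> x \<le> norm x" for x by (rule leM[OF \<phi>])
    show "\<phi> b = norm b" by (rule uniq[OF \<phi> bM])
  qed
qed

text \<open>The usual complexification: \<open>\<phi> x - i \<phi> (i x)\<close> is complex-linear,
  and its real part at \<open>b\<close> is \<open>norm b\<close>.\<close>

lemma complex_functional_nonzero_at:
  fixes b :: "'a::complex_normed_vector"
  assumes "b \<noteq> 0"
  obtains \<psi> :: "'a \<Rightarrow> complex" where "bounded_linear \<psi>" "\<And>c x. \<psi> (c *\<^sub>C x) = c * \<psi> x" "\<psi> b \<noteq> 0"
proof -
  obtain \<phi> :: "'a \<Rightarrow> real" where \<phi>: "linear \<phi>" "\<And>x. \<phi> x \<le> norm x" "\<phi> b = norm b"
    by (rule hahn_banach_norming[of b]) blast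
  interpret linear \<phi> by fact
  have abs: "\<bar>\<phi> x\<bar> \<le> norm x" for x using \<phi>(2)[of x] \<phi>(2)[of "- x"] by (simp add: neg)
  define \<psi> where "\<psi> x = Complex (\<phi> x) (- \<phi> (\<i> *\<^sub>C x))" for x
  have scal: "\<psi> (c *\<^sub>C x) = c * \<psi> x" for c x
  proof -
    have *: "\<phi> (c *\<^sub>C x) = Re c * \<phi> x + Im c * \<phi> (\<i> *\<^sub>C x)" for c x
    proof -
      have "c *\<^sub>C x = Re c *\<^sub>R x + Im c *\<^sub>R (\<i> *\<^sub>C x)"
        by (subst complex_eq[of c])
          (simp add: scaleR_scaleC scaleC_scaleC scaleC_add_left mult.commute del: complex_eq)
      then show ?thesis by (simp add: add scale)
    qed
    show ?thesis
      unfolding \<psi>_def scaleC_scaleC *[of c] *[of "\<i> * c"]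
      by (simp add: complex_eq_iff algebra_simps)
  qed
  show thesis
  proof (rule that[OF _ scal])
    show "bounded_linear \<psi>"
    proof (rule bounded_linear_intro[of _ 2])
      show "\<psi> (x + y) = \<psi> x + \<psi> y" for x y
        by (simp add: \<psi>_def complex_eq_iff add scaleC_add_right)
      show "\<psi> (r *\<^sub>R x) = r *\<^sub>R \<psi> x" for r x
        unfolding scaleR_scaleC scal by (simp add: scaleR_conv_of_real)
      show "norm (\<psi> x) \<le> norm x * 2" for x
        using cmod_le[of "\<psi> x"] abs[of x] abs[of "\<i> *\<^sub>C x"] by (simp add: \<psi>_def norm_scaleC)
    qed
    show "\<psi> b \<noteq> 0" using assms \<phi>(3) by (simp add: \<psi>_def complex_eq_iff)
  qed
qed

text \<open>Only the component \<open>w\<close> in \<open>W\<close> of a new generator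
  \<open>b\<close> is new. Intersecting \<open>W\<close> with the kernel of a continuous functional
  that does not vanish at \<open>w\<close> removes exactly this direction. The ambient space is a
  closed subspace \<open>L\<close>, because \<open>range_complement_perturb\<close> takes the
  complement inside such a subspace.\<close>

lemma closed_complement_of_cspan:
  fixes L :: "'a::complex_normed_vector set"
  assumes "finite B" and L: "csubspace L" "closed L" "B \<subseteq> L"
  shows "\<exists>W. csubspace W \<and> closed W \<and> cspan B + W = L \<and> cspan B \<inter> W = {0}"
  using assms(1,4)
proof (induction B rule: finite_induct)
  case empty
  show ?case
  proof (intro exI[of _ L] conjI)
    show "cspan {} + L = L" by (auto simp: set_plus_def)
  qed (use L complex_vector.subspace_0 in auto)
next
  case (insert b B)
  then obtain W where W: "csubspace W" "closed W" "cspan B + W = L" "cspan B \<inter> W = {0}" by auto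
  show ?case
  proof (cases "b \<in> cspan B")
    case True
    then have "cspan (insert b B) = cspan B" by (rule complex_vector.span_redundant)
    then show ?thesis using W by auto
  next
    case False
    have "b \<in> cspan B + W" using insert.prems W(3) by simp
    then obtain d w where dw: "b = d + w" "d \<in> cspan B" "w \<in> W" by (rule set_plus_elim)
    have "w \<noteq> 0" using False dw by auto
    obtain \<psi> :: "'a \<Rightarrow> complex"
      where \<psi>: "bounded_linear \<psi>" "\<And>c x. \<psi> (c *\<^sub>C x) = c * \<psi> x" "\<psi> w \<noteq> 0"
      by (rule complex_functional_nonzero_at[OF \<open>w \<noteq> 0\<close>]) blast
    interpret \<psi>: bounded_linear \<psi> by fact
    define W' where "W' = W \<inter> {x. \<psi> x = 0}"
    have W'W: "W' \<subseteq> W" by (simp add: W'_def)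
    have sub: "csubspace W'"
      using W(1) unfolding W'_def complex_vector.subspace_def by (auto simp: \<psi>.zero \<psi>.add \<psi>(2))
    have "closed W'"
      unfolding W'_def
      by (intro closed_Int W closed_Collect_eq continuous_intros linear_continuous_on \<psi>)
    moreover have "cspan (insert b B) + W' = L"
    proof
      have "cspan (insert b B) \<subseteq> L" by (rule complex_vector.span_minimal[OF insert.prems L(1)])
      moreover have "W \<subseteq> L" using W(3) subset_plus_right[of "cspan B" W] complex_vector.span_zero by blast
      ultimately show "cspan (insert b B) + W' \<subseteq> L"
        using W'W L(1) by (intro plus_subset_csubspace) auto
      show "L \<subseteq> cspan (insert b B) + W'"
      proof
        fix x assume "x \<in> L"
        then obtain s v where x: "x = s + v" "s \<in> cspan B" "v \<in> W" using W(3) by (auto elim!: set_plus_elim)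
        \<comment> \<open>This coefficient moves \<open>v\<close> into the kernel of
          \<open>\<psi>\<close>. The removed multiple of \<open>w\<close> is recovered from
          \<open>b\<close>, since \<open>w = b - d\<close>.\<close>
        define k where "k = \<psi> v / \<psi> w"
        have "v - k *\<^sub>C w \<in> W"
          using x dw W(1) by (intro complex_vector.subspace_diff complex_vector.subspace_scale)
        then have "v - k *\<^sub>C w \<in> W'" using \<psi>(3) by (simp add: W'_def \<psi>.diff \<psi>(2) k_def)
        moreover have "s + k *\<^sub>C w \<in> cspan (insert b B)"
          unfolding complex_vector.span_insert
        proof (intro CollectI exI[of _ k])
          have "s + k *\<^sub>C w - k *\<^sub>C b = s - k *\<^sub>C d" by (simp add: dw scaleC_add_right)
          then show "s + k *\<^sub>C w - k *\<^sub>C b \<in> cspan B"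
            using complex_vector.span_diff[OF x(2) complex_vector.span_scale[OF dw(2), of k]] by (rule ssubst)
        qed
        ultimately have "(s + k *\<^sub>C w) + (v - k *\<^sub>C w) \<in> cspan (insert b B) + W'" by (intro set_plus_intro)
        then show "x \<in> cspan (insert b B) + W'" by (simp add: x)
      qed
    qed
    moreover have "cspan (insert b B) \<inter> W' = {0}"
    proof
      show "cspan (insert b B) \<inter> W' \<subseteq> {0}"
      proof
        fix x assume x: "x \<in> cspan (insert b B) \<inter> W'"
        then obtain k where k: "x - k *\<^sub>C b \<in> cspan B" by (auto simp: complex_vector.span_insert)
        have "(x - k *\<^sub>C b) + k *\<^sub>C d \<in> cspan B"
          using k dw by (intro complex_vector.span_add complex_vector.span_scale)
        then have "x - k *\<^sub>C w \<in> cspan B" by (simp add: dw scaleC_add_right)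
        moreover have "x - k *\<^sub>C w \<in> W"
          using x W'W dw W(1) by (intro complex_vector.subspace_diff complex_vector.subspace_scale) auto
        ultimately have "x - k *\<^sub>C w \<in> cspan B \<inter> W" by (rule IntI)
        then have xk: "x = k *\<^sub>C w" unfolding W(4) by simp
        moreover have "\<psi> x = 0" using x by (simp add: W'_def)
        ultimately have "k = 0" using \<psi>(2,3) by simp
        then show "x \<in> {0}" using xk by simp
      qed
      show "{0} \<subseteq> cspan (insert b B) \<inter> W'"
        using complex_vector.span_zero complex_vector.subspace_0[OF sub] by blast
    qed
    ultimately show ?thesis using sub by blast
  qed
qed

section \<open>Perturbation of split operators\<close>

lemma bounded_clinear_iff:
  "bounded_clinear f \<longleftrightarrow>
    (\<forall>x y. f (x + y) = f x + f y) \<and> (\<forall>c x. f (c *\<^sub>C x) = c *\<^sub>C f x) \<and> (\<exists>K. \<forall>x. norm (f x) \<le> norm x * K)"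
  by (auto simp: bounded_clinear_def Vector_Spaces.linear_iff complex_vector.vector_space_axioms)

lemma bounded_clinear_module_hom: "bounded_clinear f \<Longrightarrow> module_hom scaleC scaleC f"
  by (simp add: bounded_clinear_def module_hom_iff_linear)

lemma bounded_clinear_imp_bounded_linear: "bounded_clinear f \<Longrightarrow> bounded_linear f"
  by (auto simp: bounded_clinear_iff scaleR_scaleC intro: bounded_linear_intro)

lemma csubspace_image: "bounded_clinear f \<Longrightarrow> csubspace M \<Longrightarrow> csubspace (f ` M)"
  unfolding csubspace_def by (rule module_hom.subspace_image[OF bounded_clinear_module_hom])

lemma csubspace_range: "bounded_clinear f \<Longrightarrow> csubspace (range f)"
  using csubspace_image[of f UNIV] by simp

lemma csubspace_null_space: "bounded_clinear f \<Longrightarrow> csubspace (null_space f)"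
  unfolding csubspace_def
  using module_hom.subspace_kernel[OF bounded_clinear_module_hom, of f] by (simp add: vimage_def)

lemma image_cspan: "bounded_clinear f \<Longrightarrow> f ` cspan B = cspan (f ` B)"
  unfolding cspan_def by (rule module_hom.span_image[OF bounded_clinear_module_hom, symmetric])

lemma range_subset_image_plus:
  assumes f: "bounded_clinear f" and NW: "N + W = UNIV" and V: "csubspace V" "f ` W \<subseteq> V" "f ` N \<subseteq> V"
  shows "range f \<subseteq> V"
proof
  interpret f: module_hom scaleC scaleC f using f by (rule bounded_clinear_module_hom)
  fix y assume "y \<in> range f"
  then obtain x where y: "y = f x" by blast
  have "x \<in> N + W" using NW by simp
  then obtain n w where "x = n + w" "n \<in> N" "w \<in> W" by (rule set_plus_elim)
  then show "y \<in> V" using V by (auto simp: y f.add intro: complex_vector.subspace_add)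
qed

text \<open>\<open>A\<close> maps \<open>L\<close> bijectively onto its range, so the direct sum of
  the image of \<open>L\<close> and a finite-dimensional \<open>cspan C\<close> survives the passage
  to \<open>B\<close>. Hence the kernel of \<open>B\<close> meets \<open>L\<close> trivially, and
  their sum misses at most finitely many dimensions; filling these enlarges \<open>L\<close> to a
  complement.\<close>

lemma null_space_complement_perturb:
  fixes A :: "'x::complex_banach \<Rightarrow> 'y::complex_banach"
  assumes A: "bounded_clinear A" and compl: "has_direct_complement (null_space A)"
    and codim: "finite_ccodim (range A)"
  shows "\<exists>e>0. \<forall>B. bounded_clinear B \<longrightarrow> (\<forall>x. norm (B x - A x) \<le> e * norm x) \<longrightarrow>
    has_direct_complement (null_space B)"
proof -
  interpret A: module_hom scaleC scaleC A using A by (rule bounded_clinear_module_hom)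
  obtain L where L: "csubspace L" "closed L" "null_space A + L = UNIV" "null_space A \<inter> L = {0}"
    using compl unfolding has_direct_complement_def by blast
  obtain C0 where "finite C0" "range A + cspan C0 = UNIV" using codim unfolding finite_ccodim_iff by blast
  then obtain C where C: "finite C" "range A \<inter> cspan C = {0}" "range A + cspan C = UNIV"
    using direct_sum_cspan[of C0 "range A"] csubspace_range[OF A] by (metis finite_subset)
  have rA: "range A = A ` L"
  proof
    show "range A \<subseteq> A ` L"
      by (rule range_subset_image_plus[OF A L(3) csubspace_image[OF A L(1)]])
        (use complex_vector.subspace_0[OF csubspace_image[OF A L(1)]] in auto)
  qed auto
  have cl: "closed (A ` L + cspan C)" using C(3) rA by simp
  have inj: "\<forall>w\<in>L. \<forall>l\<in>cspan C. A w + l = 0 \<longrightarrow> w = 0 \<and> l = 0"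
  proof (intro ballI impI)
    fix w l assume that: "w \<in> L" "l \<in> cspan C" "A w + l = 0"
    have l: "l = A (- w)" using that(3) by (simp add: A.neg add_eq_0_iff)
    then have "l \<in> range A \<inter> cspan C" using that(2) by blast
    then have "l = 0" unfolding C(2) by simp
    then have "w \<in> null_space A \<inter> L" using that by simp
    then show "w = 0 \<and> l = 0" unfolding L(4) using \<open>l = 0\<close> by simp
  qed
  obtain e where e: "e > 0"
      "\<forall>B. bounded_linear B \<longrightarrow> (\<forall>x. norm (B x - A x) \<le> e * norm x) \<longrightarrow>
        (\<forall>w\<in>L. \<forall>l\<in>cspan C. B w + l = 0 \<longrightarrow> w = 0 \<and> l = 0) \<and> closed (B ` L) \<and>
        (A ` L + cspan C = UNIV \<longrightarrow> B ` L + cspan C = UNIV)"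
    using perturb_direct_sum[OF bounded_clinear_imp_bounded_linear[OF A]
          csubspace_imp_subspace[OF L(1)] L(2)
          csubspace_imp_subspace[OF complex_vector.subspace_span] closed_cspan[OF C(1)] inj cl]
    by (elim exE conjE)
  show ?thesis
  proof (intro exI[of _ e] conjI[OF e(1)] allI impI)
    fix B :: "'x \<Rightarrow> 'y" assume B: "bounded_clinear B" "\<forall>x. norm (B x - A x) \<le> e * norm x"
    note eB = e(2)[rule_format, OF bounded_clinear_imp_bounded_linear[OF B(1)] B(2)[rule_format]]
    interpret B: module_hom scaleC scaleC B using B(1) by (rule bounded_clinear_module_hom)
    have inj: "w = 0 \<and> l = 0" if "w \<in> L" "l \<in> cspan C" "B w + l = 0" for w l
      using eB that by blast
    have onto: "B ` L + cspan C = UNIV"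
      using eB C(3) rA by simp
    \<comment> \<open>The part of \<open>cspan C\<close> that \<open>B\<close> reaches is lifted
      back to the span of a finite set \<open>G\<close>. Subtracting from \<open>y\<close> its
      \<open>L\<close>-part and such a lift leaves an element of the kernel, so \<open>G\<close>
      spans what \<open>U\<close> misses.\<close>
    have "finite_cdim (cspan C \<inter> range B)"
      by (rule finite_cdim_subspace[OF _ _ C(1)])
        (auto intro: complex_vector.subspace_inter csubspace_range B)
    then obtain D where D: "finite D" "cspan C \<inter> range B = cspan D" unfolding finite_cdim_def by blast
    then have "D \<subseteq> range B" using complex_vector.span_superset by blast
    then obtain G where G: "finite G" "D = B ` G" using D(1) finite_subset_image by metis
    define U where "U = null_space B + L"
    have U: "csubspace U" unfolding U_def by (intro csubspace_plus csubspace_null_space B L)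
    have UG: "U + cspan G = UNIV"
    proof (intro set_eqI iffI UNIV_I)
      fix y
      have "B y \<in> B ` L + cspan C" using onto by simp
      then obtain l v where lv: "B y = B l + v" "l \<in> L" "v \<in> cspan C" by (auto elim!: set_plus_elim)
      have v: "v = B (y - l)" using lv(1) by (simp add: B.diff)
      then have "v \<in> cspan C \<inter> range B" using lv(3) by blast
      then have "v \<in> B ` cspan G" unfolding D(2) G(2) image_cspan[OF B(1)] .
      then obtain g where g: "g \<in> cspan G" "v = B g" by blast
      have "y - l - g \<in> null_space B" using v g by (simp add: B.diff)
      then have "(y - l - g) + l + g \<in> U + cspan G"
        unfolding U_def by (intro set_plus_intro lv g)
      then show "y \<in> U + cspan G" by simp
    qed
    obtain G' where G': "finite G'" "U \<inter> cspan G' = {0}" "U + cspan G' = UNIV"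
      using direct_sum_cspan[OF G(1) U] UG finite_subset[OF _ G(1)] by metis
    show "has_direct_complement (null_space B)"
      unfolding has_direct_complement_def
    proof (intro exI[of _ "L + cspan G'"] conjI)
      show "csubspace (L + cspan G')" by (intro csubspace_plus L complex_vector.subspace_span)
      show "closed (L + cspan G')" by (intro closed_plus_cspan G' L)
      show "null_space B + (L + cspan G') = UNIV" using G'(3) by (simp add: U_def add.assoc)
      show "null_space B \<inter> (L + cspan G') = {0}"
      proof
        show "null_space B \<inter> (L + cspan G') \<subseteq> {0}"
        proof
          fix x assume x: "x \<in> null_space B \<inter> (L + cspan G')"
          then obtain l g where lg: "x = l + g" "l \<in> L" "g \<in> cspan G'" by (auto elim!: set_plus_elim)
          \<comment> \<open>\<open>g = x - l\<close> lies in \<open>U\<close> and in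
            \<open>cspan G'\<close>, hence vanishes; then \<open>l\<close> is in the kernel of
            \<open>B\<close>, which is injective on \<open>L\<close>.\<close>
          have "x + (- l) \<in> U"
            unfolding U_def using x lg complex_vector.subspace_neg[OF L(1)] by (intro set_plus_intro) auto
          then have "g \<in> U \<inter> cspan G'" using lg by simp
          then have "g = 0" unfolding G'(2) by simp
          then have "B l + 0 = 0" using x lg by simp
          then have "l = 0" using inj[OF lg(2) complex_vector.span_zero] by simp
          then show "x \<in> {0}" using lg \<open>g = 0\<close> by simp
        qed
        show "{0} \<subseteq> null_space B \<inter> (L + cspan G')"
          using set_plus_intro[OF complex_vector.subspace_0[OF L(1)] complex_vector.span_zero[of G']]
          by (simp add: B.zero)
      qed
    qed
  qed
qed

text \<open>\<open>W\<close> complements \<open>cspan N\<close>, which may be larger than the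
  kernel, so the image of \<open>W\<close> under \<open>A\<close> can be smaller than the range;
  \<open>L1\<close> absorbs the missing images of \<open>N\<close>. After the perturbation, the part
  of \<open>L1\<close> inside the range of \<open>B\<close> is spanned by finitely many vectors, and
  a complement of their span within \<open>L1\<close> is a complement of the range.\<close>

lemma range_complement_perturb:
  fixes A :: "'x::complex_banach \<Rightarrow> 'y::complex_banach"
  assumes A: "bounded_clinear A" and compl: "has_direct_complement (range A)"
    and N: "finite N" "null_space A \<subseteq> cspan N"
    and W: "csubspace W" "closed W" "cspan N + W = UNIV" "cspan N \<inter> W = {0}"
  shows "\<exists>e>0. \<forall>B. bounded_clinear B \<longrightarrow> (\<forall>x. norm (B x - A x) \<le> e * norm x) \<longrightarrow>
    closed (range B) \<and> has_direct_complement (range B)"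
proof -
  interpret A: module_hom scaleC scaleC A using A by (rule bounded_clinear_module_hom)
  obtain L where L: "csubspace L" "closed L" "range A + L = UNIV" "range A \<inter> L = {0}"
    using compl unfolding has_direct_complement_def by blast
  define L1 where "L1 = L + cspan (A ` N)"
  have L1: "csubspace L1" "closed L1"
    unfolding L1_def using N(1)
    by (auto intro!: csubspace_plus L complex_vector.subspace_span closed_plus_cspan)
  have sum: "A ` W + L1 = UNIV"
  proof -
    have "range A \<subseteq> A ` W + cspan (A ` N)"
    proof (rule range_subset_image_plus[OF A W(3)])
      show "csubspace (A ` W + cspan (A ` N))"
        by (intro csubspace_plus csubspace_image A W complex_vector.subspace_span)
      show "A ` W \<subseteq> A ` W + cspan (A ` N)" by (rule subset_plus_left[OF complex_vector.span_zero])
      show "A ` cspan N \<subseteq> A ` W + cspan (A ` N)"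
        unfolding image_cspan[OF A]
        by (rule subset_plus_right[OF complex_vector.subspace_0[OF csubspace_image[OF A W(1)]]])
    qed
    then have "range A + L \<subseteq> A ` W + cspan (A ` N) + L" by (rule set_plus_mono2) simp
    then show ?thesis using L(3) by (simp add: L1_def ac_simps top.extremum_unique)
  qed
  have inj: "\<forall>w\<in>W. \<forall>l\<in>L1. A w + l = 0 \<longrightarrow> w = 0 \<and> l = 0"
  proof (intro ballI impI)
    fix w l assume wl: "w \<in> W" "l \<in> L1" "A w + l = 0"
    obtain l' n where l: "l = l' + A n" "l' \<in> L" "n \<in> cspan N"
      using wl(2) unfolding L1_def image_cspan[OF A, symmetric] by (auto elim!: set_plus_elim)
    have "A (w + n) + l' = 0" using wl(3) l(1) by (simp add: A.add algebra_simps)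
    then have "l' = A (- (w + n))" unfolding A.neg by (rule minus_unique[symmetric])
    then have "l' \<in> range A \<inter> L" using l(2) by blast
    then have "l' = 0" unfolding L(4) by simp
    then have "w + n \<in> null_space A" using wl(3) l(1) by (simp add: A.add)
    then have "(w + n) - n \<in> cspan N" using N(2) l(3) complex_vector.span_diff by blast
    then have "w \<in> cspan N \<inter> W" using wl(1) by simp
    then have "w = 0" unfolding W(4) by simp
    then show "w = 0 \<and> l = 0" using wl(3) by (simp add: A.zero)
  qed
  have cl: "closed (A ` W + L1)" unfolding sum by simp
  obtain e where e: "e > 0"
      "\<forall>B. bounded_linear B \<longrightarrow> (\<forall>x. norm (B x - A x) \<le> e * norm x) \<longrightarrow>
        (\<forall>w\<in>W. \<forall>l\<in>L1. B w + l = 0 \<longrightarrow> w = 0 \<and> l = 0) \<and> closed (B ` W) \<and>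
        (A ` W + L1 = UNIV \<longrightarrow> B ` W + L1 = UNIV)"
    using perturb_direct_sum[OF bounded_clinear_imp_bounded_linear[OF A]
          csubspace_imp_subspace[OF W(1)] W(2) csubspace_imp_subspace[OF L1(1)] L1(2) inj cl]
    by (elim exE conjE)
  show ?thesis
  proof (intro exI[of _ e] conjI[OF e(1)] allI impI)
    fix B :: "'x \<Rightarrow> 'y" assume B: "bounded_clinear B" "\<forall>x. norm (B x - A x) \<le> e * norm x"
    note eB = e(2)[rule_format, OF bounded_clinear_imp_bounded_linear[OF B(1)] B(2)[rule_format]]
    interpret B: module_hom scaleC scaleC B using B(1) by (rule bounded_clinear_module_hom)
    have inj: "w = 0 \<and> l = 0" if "w \<in> W" "l \<in> L1" "B w + l = 0" for w l
      using eB that by blast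
    have clBW: "closed (B ` W)" and onto: "B ` W + L1 = UNIV" using eB sum by blast+
    have BW: "csubspace (B ` W)" by (rule csubspace_image[OF B(1) W(1)])
    have rB: "range B \<subseteq> B ` W + cspan C" if "B ` N \<subseteq> B ` W + cspan C" for C
    proof (rule range_subset_image_plus[OF B(1) W(3)])
      show sub: "csubspace (B ` W + cspan C)" by (intro csubspace_plus BW complex_vector.subspace_span)
      show "B ` W \<subseteq> B ` W + cspan C" by (rule subset_plus_left[OF complex_vector.span_zero])
      show "B ` cspan N \<subseteq> B ` W + cspan C"
        unfolding image_cspan[OF B(1)] by (rule complex_vector.span_minimal[OF that sub])
    qed
    have rB': "B ` W + cspan C \<subseteq> range B" if "C \<subseteq> range B" for C
      by (intro plus_subset_csubspace complex_vector.span_minimal that csubspace_range B) auto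
    have "B ` N \<subseteq> B ` W + cspan (B ` N)"
      by (rule subset_trans[OF complex_vector.span_superset
            subset_plus_right[OF complex_vector.subspace_0[OF BW]]])
    then have "range B = B ` W + cspan (B ` N)" by (intro subset_antisym rB rB'[OF image_mono[OF subset_UNIV]])
    then have closed: "closed (range B)" using closed_plus_cspan[OF _ BW clBW] N(1) by simp
    \<comment> \<open>The \<open>L1\<close>-component \<open>d n\<close> of \<open>B n\<close>
      equals \<open>B (n - u n)\<close>, so it lies in both \<open>L1\<close> and the range. These
      components replace the images of \<open>N\<close> as the finitely many extra generators of the
      range.\<close>
    have "\<exists>d w. w \<in> W \<and> d \<in> L1 \<and> B n = B w + d" for n
    proof -
      have "B n \<in> B ` W + L1" using onto by simp
      then show ?thesis by (auto elim!: set_plus_elim)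
    qed
    then obtain d u where d: "\<And>n. u n \<in> W" "\<And>n. d n \<in> L1" "\<And>n. B n = B (u n) + d n" by metis
    define C where "C = d ` N"
    have C: "finite C" "C \<subseteq> L1" using N(1) d by (auto simp: C_def)
    have "d n = B (n - u n)" for n by (simp add: B.diff d(3)[of n])
    then have CB: "C \<subseteq> range B" by (auto simp: C_def)
    have "B ` N \<subseteq> B ` W + cspan C"
    proof
      fix y assume "y \<in> B ` N"
      then obtain n where n: "n \<in> N" "y = B (u n) + d n" using d(3) by blast
      then show "y \<in> B ` W + cspan C"
        using d(1) by (auto intro!: set_plus_intro complex_vector.span_base simp: C_def)
    qed
    then have rBC: "range B \<subseteq> B ` W + cspan C" by (rule rB)
    obtain V where V: "csubspace V" "closed V" "cspan C + V = L1" "cspan C \<inter> V = {0}"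
      using closed_complement_of_cspan[OF C(1) L1 C(2)] by blast
    have "has_direct_complement (range B)"
      unfolding has_direct_complement_def
    proof (intro exI[of _ V] conjI V)
      have "UNIV = B ` W + cspan C + V" using onto V(3) by (simp add: add.assoc)
      also have "\<dots> \<subseteq> range B + V" by (intro set_plus_mono2 rB' CB) simp
      finally show "range B + V = UNIV" by blast
      show "range B \<inter> V = {0}"
      proof
        show "range B \<inter> V \<subseteq> {0}"
        proof
          fix x assume x: "x \<in> range B \<inter> V"
          then obtain w s where ws: "x = B w + s" "w \<in> W" "s \<in> cspan C"
            using rBC by (auto elim!: set_plus_elim dest!: subsetD)
          have "V \<subseteq> L1" using subset_plus_right[of "cspan C" V] complex_vector.span_zero V(3) by blast
          moreover have "s \<in> L1" using complex_vector.span_minimal[OF C(2) L1(1)] ws(3) by blast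
          ultimately have "s - x \<in> L1" using x L1(1) by (intro complex_vector.subspace_diff) auto
          moreover have "B w + (s - x) = 0" using ws(1) by simp
          ultimately have "s - x = 0" using inj[OF ws(2)] by blast
          then have "x \<in> cspan C \<inter> V" using ws(3) x by simp
          then show "x \<in> {0}" unfolding V(4) .
        qed
        show "{0} \<subseteq> range B \<inter> V"
          using complex_vector.subspace_0[OF csubspace_range[OF B(1)]] complex_vector.subspace_0[OF V(1)] by simp
      qed
    qed
    then show "closed (range B) \<and> has_direct_complement (range B)" using closed by blast
  qed
qed

text \<open>The map \<open>(w, m) \<mapsto> A w + m\<close> is injective on
  \<open>W \<times> cspan M\<close> with closed range, and injectivity survives the perturbation. If
  \<open>B x\<close> lies in \<open>cspan M\<close>, then so does \<open>B w\<close> for the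
  \<open>W\<close>-component \<open>w\<close> of \<open>x\<close>, because \<open>B\<close> maps
  \<open>N\<close> into \<open>cspan M\<close>; hence \<open>w = 0\<close>.\<close>

lemma preimage_subset_perturb:
  fixes A :: "'x::complex_banach \<Rightarrow> 'y::complex_banach"
  assumes A: "bounded_clinear A" and cl: "closed (range A)"
    and W: "csubspace W" "closed W" "N + W = UNIV" "N \<inter> W = {0}"
    and M: "finite M" "A ` N \<subseteq> cspan M" and pre: "\<And>x. A x \<in> cspan M \<Longrightarrow> x \<in> N"
  shows "\<exists>e>0. \<forall>B. bounded_clinear B \<longrightarrow> (\<forall>x. norm (B x - A x) \<le> e * norm x) \<longrightarrow>
    B ` N \<subseteq> cspan M \<longrightarrow> (\<forall>x. B x \<in> cspan M \<longrightarrow> x \<in> N)"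
proof -
  interpret A: module_hom scaleC scaleC A using A by (rule bounded_clinear_module_hom)
  have inj: "\<forall>w\<in>W. \<forall>l\<in>cspan M. A w + l = 0 \<longrightarrow> w = 0 \<and> l = 0"
  proof (intro ballI impI)
    fix w l assume wl: "w \<in> W" "l \<in> cspan M" "A w + l = 0"
    have "A w = - l" using wl(3) by (simp add: eq_neg_iff_add_eq_0)
    then have "A w \<in> cspan M" using complex_vector.span_neg[OF wl(2)] by simp
    then have "w \<in> N \<inter> W" using pre wl(1) by blast
    then have "w = 0" unfolding W(4) by simp
    then show "w = 0 \<and> l = 0" using wl(3) by (simp add: A.zero)
  qed
  have "A ` W + cspan M = range A + cspan M"
  proof
    show "A ` W + cspan M \<subseteq> range A + cspan M" by (intro set_plus_mono2) auto
    have sub: "csubspace (A ` W + cspan M)"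
      by (intro csubspace_plus csubspace_image A W complex_vector.subspace_span)
    have 0: "cspan M \<subseteq> A ` W + cspan M"
      by (rule subset_plus_right[OF complex_vector.subspace_0[OF csubspace_image[OF A W(1)]]])
    have "range A \<subseteq> A ` W + cspan M"
      using M(2) 0
      by (intro range_subset_image_plus[OF A W(3) sub] subset_plus_left[OF complex_vector.span_zero]) auto
    then show "range A + cspan M \<subseteq> A ` W + cspan M"
      using 0 by (intro plus_subset_csubspace sub)
  qed
  then have cl': "closed (A ` W + cspan M)"
    using closed_plus_cspan[OF M(1) csubspace_range[OF A] cl] by simp
  obtain e where e: "e > 0"
      "\<forall>B. bounded_linear B \<longrightarrow> (\<forall>x. norm (B x - A x) \<le> e * norm x) \<longrightarrow>
        (\<forall>w\<in>W. \<forall>l\<in>cspan M. B w + l = 0 \<longrightarrow> w = 0 \<and> l = 0) \<and> closed (B ` W) \<and>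
        (A ` W + cspan M = UNIV \<longrightarrow> B ` W + cspan M = UNIV)"
    using perturb_direct_sum[OF bounded_clinear_imp_bounded_linear[OF A]
          csubspace_imp_subspace[OF W(1)] W(2)
          csubspace_imp_subspace[OF complex_vector.subspace_span] closed_cspan[OF M(1)] inj cl']
    by (elim exE conjE)
  show ?thesis
  proof (intro exI[of _ e] conjI[OF e(1)] allI impI)
    fix B :: "'x \<Rightarrow> 'y" and x
    assume B: "bounded_clinear B" "\<forall>x. norm (B x - A x) \<le> e * norm x" "B ` N \<subseteq> cspan M" "B x \<in> cspan M"
    interpret B: module_hom scaleC scaleC B using B(1) by (rule bounded_clinear_module_hom)
    have "x \<in> N + W" using W(3) by simp
    then obtain n w where x: "x = n + w" "n \<in> N" "w \<in> W" by (rule set_plus_elim)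
    have "B n - B x \<in> cspan M" using B(3,4) x(2) by (intro complex_vector.span_diff) auto
    moreover have "B w + (B n - B x) = 0" by (simp add: x B.add)
    ultimately have "w = 0"
      using e(2)[rule_format, OF bounded_clinear_imp_bounded_linear[OF B(1)] B(2)[rule_format]] x(3) by blast
    then show "x \<in> N" using x by simp
  qed
qed

section \<open>Commuting tuples\<close>

lemma bounded_clinear_power:
  fixes f :: "'a \<Rightarrow> 'a::complex_normed_vector"
  assumes "bounded_clinear f"
  shows "bounded_clinear (f ^^ k)"
proof (induction k)
  case 0
  show ?case unfolding bounded_clinear_iff by (auto intro: exI[of _ 1])
next
  case (Suc k)
  have *: "bounded_linear (f \<circ> (f ^^ k))"
    unfolding comp_def
    by (rule bounded_linear_compose[OF bounded_clinear_imp_bounded_linear[OF assms]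
          bounded_clinear_imp_bounded_linear[OF Suc]])
  show ?case
    using Suc assms bounded_linear.bounded[OF *] unfolding bounded_clinear_iff by simp
qed

lemma bounded_clinear_tuple_hat:
  assumes "\<And>i. bounded_clinear (T i)"
  shows "bounded_clinear (tuple_hat T)"
proof -
  have "\<forall>i. \<exists>K. \<forall>x. norm (T i x) \<le> norm x * K" using assms by (auto simp: bounded_clinear_iff)
  then obtain K where K: "\<And>i x. norm (T i x) \<le> norm x * K i" by metis
  have "norm (tuple_hat T x) \<le> norm x * (\<Sum>i\<in>UNIV. \<bar>K i\<bar>)" for x
  proof -
    have "norm (T i (x $ i)) \<le> norm x * \<bar>K i\<bar>" for i
    proof -
      have "norm (T i (x $ i)) \<le> norm (x $ i) * \<bar>K i\<bar>"
        by (rule order_trans[OF K]) (intro mult_left_mono abs_ge_self norm_ge_zero)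
      also have "\<dots> \<le> norm x * \<bar>K i\<bar>" by (intro mult_right_mono Finite_Cartesian_Product.norm_nth_le) auto
      finally show ?thesis .
    qed
    then show ?thesis unfolding tuple_hat_def sum_distrib_left by (intro sum_norm_le)
  qed
  moreover have "tuple_hat T (x + y) = tuple_hat T x + tuple_hat T y" for x y
    using assms by (simp add: tuple_hat_def bounded_clinear_iff sum.distrib)
  moreover have "tuple_hat T (c *\<^sub>C x) = c *\<^sub>C tuple_hat T x" for c x
    using assms by (simp add: tuple_hat_def scaleC_vec_def bounded_clinear_iff complex_vector.scale_sum_right)
  ultimately show ?thesis unfolding bounded_clinear_iff by blast
qed

lemma norm_vec_le_sum: "norm (x :: 'a::real_normed_vector ^ 'n) \<le> (\<Sum>i\<in>UNIV. norm (x $ i))"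
  unfolding norm_vec_def by (rule L2_set_le_sum) simp

lemma bounded_clinear_tuple_tilde:
  assumes "\<And>i. bounded_clinear (T i)"
  shows "bounded_clinear (tuple_tilde T)"
proof -
  have "\<forall>i. \<exists>K. \<forall>x. norm (T i x) \<le> norm x * K" using assms by (auto simp: bounded_clinear_iff)
  then obtain K where K: "\<And>i x. norm (T i x) \<le> norm x * K i" by metis
  have "norm (tuple_tilde T x) \<le> norm x * (\<Sum>i\<in>UNIV. K i)" for x
    by (rule order_trans[OF norm_vec_le_sum])
      (auto simp: tuple_tilde_def sum_distrib_left intro!: sum_mono K)
  moreover have "tuple_tilde T (x + y) = tuple_tilde T x + tuple_tilde T y" for x y
    using assms by (simp add: tuple_tilde_def bounded_clinear_iff vec_eq_iff)
  moreover have "tuple_tilde T (c *\<^sub>C x) = c *\<^sub>C tuple_tilde T x" for c x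
    using assms by (simp add: tuple_tilde_def scaleC_vec_def bounded_clinear_iff)
  ultimately show ?thesis unfolding bounded_clinear_iff by blast
qed

lemma bounded_clinear_tuple_shift:
  assumes "bounded_clinear (T i)"
  shows "bounded_clinear (tuple_shift T z i)"
proof -
  obtain K where K: "\<And>x. norm (T i x) \<le> norm x * K" using assms by (auto simp: bounded_clinear_iff)
  have "norm (tuple_shift T z i x) \<le> norm x * (K + cmod (z $ i))" for x
    unfolding tuple_shift_def
    by (rule order_trans[OF norm_triangle_ineq4]) (use K[of x] in \<open>simp add: norm_scaleC algebra_simps\<close>)
  moreover have "tuple_shift T z i (x + y) = tuple_shift T z i x + tuple_shift T z i y" for x y
    using assms by (simp add: tuple_shift_def bounded_clinear_iff scaleC_add_right)
  moreover have "tuple_shift T z i (c *\<^sub>C x) = c *\<^sub>C tuple_shift T z i x" for c x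
    using assms by (simp add: tuple_shift_def bounded_clinear_iff scaleC_scaleC mult.commute
        complex_vector.scale_right_diff_distrib)
  ultimately show ?thesis unfolding bounded_clinear_iff by blast
qed

lemma commute_tuple_shift:
  assumes "\<And>i. bounded_clinear (T i)" "\<And>i j. T i \<circ> T j = T j \<circ> T i"
  shows "tuple_shift T z i \<circ> tuple_shift T z j = tuple_shift T z j \<circ> tuple_shift T z i"
proof
  fix x
  have T: "T i (u - v) = T i u - T i v" "T i (c *\<^sub>C u) = c *\<^sub>C T i u" for i u v c
    using module_hom.diff[OF bounded_clinear_module_hom[OF assms(1)]]
      module_hom.scale[OF bounded_clinear_module_hom[OF assms(1)]] by auto
  have "T i (T j x) = T j (T i x)" using assms(2)[of i j] by (auto simp: fun_eq_iff)
  then show "(tuple_shift T z i \<circ> tuple_shift T z j) x = (tuple_shift T z j \<circ> tuple_shift T z i) x"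
    by (simp add: tuple_shift_def T complex_vector.scale_right_diff_distrib scaleC_scaleC mult.commute)
qed

lemma tuple_shift_shift: "tuple_shift (tuple_shift T z) w = tuple_shift T (z + w)"
  by (simp add: fun_eq_iff tuple_shift_def scaleC_add_left diff_diff_eq)

lemma norm_tuple_hat_shift_diff:
  "norm (tuple_hat (tuple_shift T w) x - tuple_hat T x) \<le> real CARD('n) * norm w * norm x"
  for x :: "'a::complex_normed_vector ^ 'n::finite"
proof -
  have "tuple_hat (tuple_shift T w) x - tuple_hat T x = - (\<Sum>i\<in>UNIV. (w $ i) *\<^sub>C (x $ i))"
    by (simp add: tuple_hat_def tuple_shift_def sum_subtractf)
  also have "norm \<dots> \<le> (\<Sum>i\<in>(UNIV :: 'n set). norm w * norm x)"
    unfolding norm_minus_cancel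
    by (rule sum_norm_le)
      (auto simp: norm_scaleC intro!: mult_mono Finite_Cartesian_Product.norm_nth_le)
  finally show ?thesis by (simp add: mult.assoc)
qed

lemma norm_tuple_tilde_shift_diff:
  "norm (tuple_tilde (tuple_shift T w) x - tuple_tilde T x) \<le> real CARD('n) * norm w * norm x"
  for w :: "complex ^ 'n::finite"
proof -
  have "norm (tuple_tilde (tuple_shift T w) x - tuple_tilde T x) \<le> (\<Sum>i\<in>(UNIV :: 'n set). norm w * norm x)"
    by (rule order_trans[OF norm_vec_le_sum], rule sum_mono)
      (auto simp: tuple_tilde_def tuple_shift_def norm_scaleC
        intro!: mult_right_mono Finite_Cartesian_Product.norm_nth_le)
  then show ?thesis by (simp add: mult.assoc)
qed

section \<open>Joint ranges and joint kernels of powers\<close>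

lemma sum_range_eq_range_tuple_hat: "(\<Sum>i\<in>UNIV. range (T i)) = range (tuple_hat T)"
proof -
  have "(\<Sum>i\<in>UNIV. range (T i)) = {sum s UNIV | s. \<forall>i\<in>UNIV. s i \<in> range (T i)}"
    by (rule set_sum_alt) simp
  also have "\<dots> = range (tuple_hat T)"
  proof (intro set_eqI iffI)
    fix y assume "y \<in> {sum s UNIV | s. \<forall>i\<in>UNIV. s i \<in> range (T i)}"
    then obtain s where s: "y = sum s UNIV" "\<forall>i. \<exists>u. s i = T i u" by blast
    then obtain u where "\<And>i. s i = T i (u i)" by metis
    then have "y = tuple_hat T (\<chi> i. u i)" using s by (simp add: tuple_hat_def)
    then show "y \<in> range (tuple_hat T)" by blast
  next
    fix y assume "y \<in> range (tuple_hat T)"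
    then obtain x where "y = (\<Sum>i\<in>UNIV. T i (x $ i))" by (auto simp: tuple_hat_def)
    then show "y \<in> {sum s UNIV | s. \<forall>i\<in>UNIV. s i \<in> range (T i)}" by blast
  qed
  finally show ?thesis .
qed

text \<open>Each set in the intersection becomes the range of a single operator, bounded if the
  \<open>T i\<close> are, so open mapping and closed range arguments apply to it.\<close>

lemma R_infinity_eq: "R_infinity T = (\<Inter>k\<in>{1..}. range (tuple_hat (\<lambda>i. T i ^^ k)))"
  unfolding R_infinity_def sum_range_eq_range_tuple_hat ..

lemma in_range_tuple_hat: "(\<Sum>i\<in>UNIV. T i (u i)) \<in> range (tuple_hat T)"
  by (rule range_eqI[of _ _ "\<chi> i. u i"]) (simp add: tuple_hat_def)

lemma funpow_commute:
  assumes "f \<circ> g = g \<circ> f"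
  shows "(f ^^ k) (g x) = g ((f ^^ k) x)"
  using assms by (induction k) (auto simp: fun_eq_iff)

lemma in_range_tuple_hat_single:
  assumes "\<And>i. bounded_clinear (T i)"
  shows "T j u \<in> range (tuple_hat T)"
proof -
  have "T i 0 = 0" for i using module_hom.zero[OF bounded_clinear_module_hom[OF assms]] .
  then have "(\<Sum>i\<in>UNIV. T i (if i = j then u else 0)) = T j u"
    by (subst sum.remove[of _ j]) (auto intro: sum.neutral)
  then show ?thesis using in_range_tuple_hat[of T "\<lambda>i. if i = j then u else 0"] by simp
qed

lemma decrement_sum:
  fixes \<alpha> :: "'n::finite \<Rightarrow> nat"
  assumes "\<alpha> i \<noteq> 0"
  shows "sum (\<alpha>(i := \<alpha> i - 1)) UNIV < sum \<alpha> UNIV"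
  using assms by (intro sum_strict_mono_ex1) auto

text \<open>Substituting the representation of elements of \<open>M\<close> into itself reaches
  arbitrary powers. The exponents form a multi-index, because one substitution lowers only one of
  them; the induction is on their sum, and an exponent 0 makes the claim trivial.\<close>

lemma subset_range_tuple_hat_powers:
  fixes S :: "'n::finite \<Rightarrow> 'a \<Rightarrow> 'a::complex_normed_vector"
  assumes S: "\<And>i. bounded_clinear (S i)" and comm: "\<And>i j. S i \<circ> S j = S j \<circ> S i"
    and M: "\<And>x. x \<in> M \<Longrightarrow> \<exists>u. (\<forall>i. u i \<in> M) \<and> x = (\<Sum>i\<in>UNIV. S i (u i))"
    and x: "x \<in> M"
  shows "x \<in> range (tuple_hat (\<lambda>i. S i ^^ \<alpha> i))"
  using x
proof (induction "sum \<alpha> UNIV" arbitrary: \<alpha> x rule: less_induct)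
  case less
  have P: "bounded_clinear (S i ^^ \<alpha> i)" for i by (intro bounded_clinear_power S)
  note hat = bounded_clinear_tuple_hat[of "\<lambda>i. S i ^^ \<alpha> i", OF P]
  show ?case
  proof (cases "\<exists>i. \<alpha> i = 0")
    case True
    then obtain i where "\<alpha> i = 0" by blast
    then show ?thesis using in_range_tuple_hat_single[of "\<lambda>i. S i ^^ \<alpha> i", OF P, of i x] by simp
  next
    case False
    obtain u where u: "\<And>i. u i \<in> M" "x = (\<Sum>i\<in>UNIV. S i (u i))" using M[OF less.prems] by blast
    have "S i (u i) \<in> range (tuple_hat (\<lambda>j. S j ^^ \<alpha> j))" for i
    proof -
      define \<beta> where "\<beta> = \<alpha>(i := \<alpha> i - 1)"
      have "sum \<beta> UNIV < sum \<alpha> UNIV" unfolding \<beta>_def using False by (intro decrement_sum) auto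
      then have "u i \<in> range (tuple_hat (\<lambda>j. S j ^^ \<beta> j))" using u(1) by (rule less.hyps)
      then obtain v where v: "u i = (\<Sum>j\<in>UNIV. (S j ^^ \<beta> j) (v $ j))" by (auto simp: tuple_hat_def)
      have "S i (u i) = (\<Sum>j\<in>UNIV. S i ((S j ^^ \<beta> j) (v $ j)))"
        unfolding v by (rule module_hom.sum[OF bounded_clinear_module_hom[OF S]])
      \<comment> \<open>For \<open>j = i\<close> the additional \<open>S i\<close> restores the
        lowered exponent; for the other \<open>j\<close> it commutes past the power and is absorbed
        into the argument.\<close>
      also have "\<dots> = (\<Sum>j\<in>UNIV. (S j ^^ \<alpha> j) (if j = i then v $ j else S i (v $ j)))"
      proof (rule sum.cong[OF refl])
        fix j
        have "S i ((S i ^^ (\<alpha> i - 1)) y) = (S i ^^ \<alpha> i) y" for y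
        proof -
          have "(S i ^^ Suc (\<alpha> i - 1)) y = (S i ^^ \<alpha> i) y" using False by simp
          then show ?thesis by simp
        qed
        then show "S i ((S j ^^ \<beta> j) (v $ j)) = (S j ^^ \<alpha> j) (if j = i then v $ j else S i (v $ j))"
          using funpow_commute[OF comm[of j i]] by (simp add: \<beta>_def)
      qed
      also have "\<dots> \<in> range (tuple_hat (\<lambda>j. S j ^^ \<alpha> j))" by (rule in_range_tuple_hat)
      finally show ?thesis .
    qed
    then show ?thesis
      unfolding u(2) by (intro complex_vector.subspace_sum csubspace_range hat)
  qed
qed

text \<open>Passing from \<open>x\<close> to \<open>S i x\<close> lowers the exponent at
  \<open>i\<close>, so by induction on the sum of the exponents every \<open>S i x\<close> lies in
  \<open>N\<close>, and with it \<open>x\<close>. An exponent 0 forces \<open>x = 0\<close>.\<close>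

lemma joint_power_kernel_subset:
  fixes S :: "'n::finite \<Rightarrow> 'a \<Rightarrow> 'a::complex_normed_vector"
  assumes S: "\<And>i. bounded_clinear (S i)" and comm: "\<And>i j. S i \<circ> S j = S j \<circ> S i"
    and N: "0 \<in> N" "\<And>x. (\<And>i. S i x \<in> N) \<Longrightarrow> x \<in> N"
    and x: "\<And>i. (S i ^^ \<alpha> i) x = 0"
  shows "x \<in> N"
  using x
proof (induction "sum \<alpha> UNIV" arbitrary: \<alpha> x rule: less_induct)
  case less
  show ?case
  proof (cases "\<exists>i. \<alpha> i = 0")
    case True
    then obtain i where "\<alpha> i = 0" by blast
    then show ?thesis using less.prems[of i] N(1) by simp
  next
    case False
    show ?thesis
    proof (rule N(2))
      fix i
      define \<beta> where "\<beta> = \<alpha>(i := \<alpha> i - 1)"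
      have "sum \<beta> UNIV < sum \<alpha> UNIV" unfolding \<beta>_def using False by (intro decrement_sum) auto
      then show "S i x \<in> N"
      proof (rule less.hyps)
        fix j
        show "(S j ^^ \<beta> j) (S i x) = 0"
        proof (cases "j = i")
          case True
          have "(S i ^^ Suc (\<alpha> i - 1)) x = 0" using False less.prems[of i] by simp
          then show ?thesis using True by (simp add: \<beta>_def funpow_swap1)
        next
          case ne: False
          then show ?thesis
            using funpow_commute[OF comm[of j i], of "\<alpha> j" x] less.prems[of j]
              module_hom.zero[OF bounded_clinear_module_hom[OF S]] by (simp add: \<beta>_def)
        qed
      qed
    qed
  qed
qed

section \<open>Stability of the semi-Browder tuples\<close>

lemma R_infinity_perturb:
  fixes T :: "'n::finite \<Rightarrow> 'a \<Rightarrow> 'a::complex_banach"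
  assumes T: "\<And>i. bounded_clinear (T i)" and comm: "\<And>i j. T i \<circ> T j = T j \<circ> T i"
    and codim: "finite_ccodim (R_infinity T)"
  shows "\<exists>e>0. \<forall>w. real CARD('n) * norm w \<le> e \<longrightarrow> finite_ccodim (R_infinity (tuple_shift T w))"
proof -
  define R where "R k = range (tuple_hat (\<lambda>i. T i ^^ k))" for k
  define M where "M = R_infinity T"
  have P: "bounded_clinear (T i ^^ k)" for i k by (rule bounded_clinear_power[OF T])
  have subR: "csubspace (R k)" for k
    unfolding R_def by (intro csubspace_range bounded_clinear_tuple_hat P)
  have anti: "R k \<subseteq> R j" if "j \<le> k" for j k
  proof
    fix y assume "y \<in> R k"
    then obtain x where y: "y = (\<Sum>i\<in>UNIV. (T i ^^ k) (x $ i))" by (auto simp: R_def tuple_hat_def)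
    have "(T i ^^ k) u = (T i ^^ j) ((T i ^^ (k - j)) u)" for i u
      using that funpow_add[of j "k - j" "T i"] by simp
    then have "y = (\<Sum>i\<in>UNIV. (T i ^^ j) ((T i ^^ (k - j)) (x $ i)))" by (simp only: y)
    then show "y \<in> R j" unfolding R_def by (simp only: in_range_tuple_hat[of "\<lambda>i. T i ^^ j"])
  qed
  have M: "M = (\<Inter>k\<in>{1..}. R k)" by (simp add: M_def R_infinity_eq R_def)
  have "\<exists>k\<ge>1. \<forall>j\<ge>k. R j = M"
    unfolding M
  proof (rule descending_chain_stabilizes[OF subR])
    show "R k \<subseteq> R j" if "j \<le> k" for j k by (rule anti[OF that])
    show "finite_ccodim (\<Inter>k\<in>{1..}. R k)" using codim unfolding M[symmetric] M_def .
  qed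
  then obtain K where K: "K \<ge> 1" "\<And>j. j \<ge> K \<Longrightarrow> R j = M" by auto
  have subM: "csubspace M" using subR[of K] K(2)[of K] by simp
  obtain C0 where C0: "finite C0" "M + cspan C0 = UNIV" using codim unfolding finite_ccodim_iff M_def by blast
  then obtain C where C: "finite C" "M \<inter> cspan C = {0}" "M + cspan C = UNIV"
    using direct_sum_cspan[OF C0(1) subM] finite_subset[OF _ C0(1)] by metis
  have MK: "M = range (tuple_hat (\<lambda>i. T i ^^ K))" using K(2)[of K] by (simp add: R_def)
  \<comment> \<open>By stabilization the whole intersection is the range of one bounded operator,
    and \<open>cspan C\<close> is a closed complement of it.\<close>
  have clM: "closed M"
    unfolding MK
    by (rule closed_range_if_closed_complement[OF bounded_clinear_imp_bounded_linear[OF bounded_clinear_tuple_hat[OF P]]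
          csubspace_imp_subspace[OF complex_vector.subspace_span] closed_cspan[OF C(1)]])
      (use C MK in simp_all)
  have TM: "T i m \<in> M" if "m \<in> M" for i m
  proof -
    obtain x where "m = (\<Sum>j\<in>UNIV. (T j ^^ K) (x $ j))" using \<open>m \<in> M\<close> unfolding MK by (auto simp: tuple_hat_def)
    then have "T i m = (\<Sum>j\<in>UNIV. (T j ^^ K) (T i (x $ j)))"
      using module_hom.sum[OF bounded_clinear_module_hom[OF T]] funpow_commute[OF comm] by simp
    then show ?thesis unfolding MK by (simp only: in_range_tuple_hat[of "\<lambda>i. T i ^^ K"])
  qed
  define V where "V = {x :: 'a ^ 'n. \<forall>i. x $ i \<in> M}"
  have V: "subspace V" "closed V"
  proof -
    have subM': "subspace M" by (rule csubspace_imp_subspace[OF subM])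
    show "subspace V"
      using subspace_0[OF subM'] subspace_add[OF subM'] subspace_scale[OF subM']
      by (auto simp: V_def subspace_def)
    have "V = (\<Inter>i. (\<lambda>x. x $ i) -` M)" by (auto simp: V_def)
    then show "closed V"
      by (auto intro!: closed_INT closed_vimage clM continuous_intros)
  qed
  have hatV: "tuple_hat T ` V = M"
  proof
    show "tuple_hat T ` V \<subseteq> M"
      using TM by (auto simp: V_def tuple_hat_def intro!: complex_vector.subspace_sum[OF subM])
    show "M \<subseteq> tuple_hat T ` V"
    proof
      fix m assume "m \<in> M"
      \<comment> \<open>The exponent \<open>Suc K\<close> allows one factor \<open>T i\<close> to be
        split off; the vectors that remain are in the range of \<open>T i ^^ K\<close> and so still
        in \<open>M\<close>.\<close>
      then have "m \<in> R (Suc K)" using K(2)[of "Suc K"] by simp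
      then obtain x where m: "m = (\<Sum>i\<in>UNIV. T i ((T i ^^ K) (x $ i)))" by (auto simp: R_def tuple_hat_def)
      have "(T i ^^ K) (x $ i) \<in> M" for i
        unfolding MK by (rule in_range_tuple_hat_single[of "\<lambda>i. T i ^^ K", OF P])
      then show "m \<in> tuple_hat T ` V"
        by (intro image_eqI[of _ _ "\<chi> i. (T i ^^ K) (x $ i)"]) (auto simp: V_def tuple_hat_def m)
    qed
  qed
  have hatT: "bounded_linear (tuple_hat T)"
    by (intro bounded_clinear_imp_bounded_linear bounded_clinear_tuple_hat T)
  obtain c where c: "c > 0" "\<And>y. y \<in> M \<Longrightarrow> \<exists>x\<in>V. tuple_hat T x = y \<and> norm x \<le> c * norm y"
    using open_mapping_onto_closed[OF hatT V] clM unfolding hatV by metis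
  show ?thesis
  proof (intro exI[of _ "1 / (2 * c)"] conjI allI impI)
    \<comment> \<open>This radius gives \<open>perturb_onto\<close> the contraction factor
      1/2.\<close>
    show "1 / (2 * c) > 0" using c by simp
    fix w :: "complex ^ 'n" assume w: "real CARD('n) * norm w \<le> 1 / (2 * c)"
    define S where "S = tuple_shift T w"
    have S: "bounded_clinear (S i)" for i unfolding S_def by (intro bounded_clinear_tuple_shift T)
    have commS: "S i \<circ> S j = S j \<circ> S i" for i j unfolding S_def by (intro commute_tuple_shift T comm)
    have SM: "S i m \<in> M" if "m \<in> M" for i m
      using TM[OF that] that subM
      by (auto simp: S_def tuple_shift_def intro!: complex_vector.subspace_diff complex_vector.subspace_scale)
    have near: "norm (tuple_hat S x - tuple_hat T x) \<le> 1 / (2 * c) * norm x" for x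
      unfolding S_def
      by (rule order_trans[OF norm_tuple_hat_shift_diff]) (use w in \<open>intro mult_right_mono, auto\<close>)
    have SV: "tuple_hat S ` V \<subseteq> M"
      using SM by (auto simp: V_def tuple_hat_def intro!: complex_vector.subspace_sum[OF subM])
    have "tuple_hat S ` V = M"
    proof (rule perturb_onto[OF hatT _ V csubspace_imp_subspace[OF subM] SV _ c(2) _ near])
      show "bounded_linear (tuple_hat S)"
        by (intro bounded_clinear_imp_bounded_linear bounded_clinear_tuple_hat S)
    qed (use c in auto)
    then have onto: "\<exists>u. (\<forall>i. u i \<in> M) \<and> x = (\<Sum>i\<in>UNIV. S i (u i))" if "x \<in> M" for x
    proof -
      obtain v where "v \<in> V" "x = tuple_hat S v" using \<open>x \<in> M\<close> \<open>tuple_hat S ` V = M\<close> by blast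
      then show ?thesis by (intro exI[of _ "\<lambda>i. v $ i"]) (auto simp: V_def tuple_hat_def)
    qed
    have "M \<subseteq> R_infinity S"
      unfolding R_infinity_eq
    proof (intro INT_greatest subsetI)
      fix k x assume "x \<in> M"
      show "x \<in> range (tuple_hat (\<lambda>i. S i ^^ k))"
        by (rule subset_range_tuple_hat_powers[OF S commS _ \<open>x \<in> M\<close>]) (rule onto)
    qed
    then have "M + cspan C \<subseteq> R_infinity S + cspan C" by (intro set_plus_mono2) auto
    then have "R_infinity S + cspan C = UNIV" using C(3) by auto
    then show "finite_ccodim (R_infinity (tuple_shift T w))"
      using C(1) unfolding finite_ccodim_iff S_def by blast
  qed
qed

lemma finite_ccodim_mono: "finite_ccodim M \<Longrightarrow> M \<subseteq> M' \<Longrightarrow> finite_ccodim M'"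
  unfolding finite_ccodim_def by (meson subsetD)

lemma lower_split_semi_Browder_perturb:
  fixes T :: "'n::finite \<Rightarrow> 'a \<Rightarrow> 'a::complex_banach"
  assumes T: "\<And>i. bounded_clinear (T i)" and comm: "\<And>i j. T i \<circ> T j = T j \<circ> T i"
    and low: "lower_split_semi_Browder T"
  shows "\<exists>e>0. \<forall>w. real CARD('n) * norm w \<le> e \<longrightarrow> lower_split_semi_Browder (tuple_shift T w)"
proof -
  have codim: "finite_ccodim (R_infinity T)" and compl: "has_direct_complement (null_space (tuple_hat T))"
    using low by (auto simp: lower_split_semi_Browder_def)
  \<comment> \<open>The set with exponent 1 is the range of the row operator itself, which therefore
    has finite codimension.\<close>
  have "R_infinity T \<subseteq> range (tuple_hat (\<lambda>i. T i ^^ 1))" unfolding R_infinity_eq by (rule INF_lower) simp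
  then have "finite_ccodim (range (tuple_hat T))" using finite_ccodim_mono[OF codim] by simp
  then obtain e where e: "e > 0" "\<forall>B. bounded_clinear B \<longrightarrow> (\<forall>x. norm (B x - tuple_hat T x) \<le> e * norm x) \<longrightarrow>
      has_direct_complement (null_space B)"
    using null_space_complement_perturb[OF bounded_clinear_tuple_hat[OF T] compl] by blast
  obtain d where d: "d > 0"
      "\<forall>w. real CARD('n) * norm w \<le> d \<longrightarrow> finite_ccodim (R_infinity (tuple_shift T w))"
    using R_infinity_perturb[OF T comm codim] by blast
  show ?thesis
  proof (intro exI[of _ "min e d"] conjI allI impI)
    show "min e d > 0" using e d by simp
    fix w :: "complex ^ 'n" assume w: "real CARD('n) * norm w \<le> min e d"
    have "norm (tuple_hat (tuple_shift T w) x - tuple_hat T x) \<le> e * norm x" for x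
      by (rule order_trans[OF norm_tuple_hat_shift_diff]) (use w in \<open>intro mult_right_mono, auto\<close>)
    then have "has_direct_complement (null_space (tuple_hat (tuple_shift T w)))"
      using e(2) bounded_clinear_tuple_hat[of "tuple_shift T w", OF bounded_clinear_tuple_shift[OF T]] by blast
    then show "lower_split_semi_Browder (tuple_shift T w)"
      using d(2) w unfolding lower_split_semi_Browder_def by simp
  qed
qed

section \<open>Stability in the upper case\<close>

lemma finite_cdim_vec:
  fixes N :: "'a::complex_normed_vector set"
  assumes "finite B" "N = cspan B"
  shows "finite_cdim {y :: 'a ^ 'n::finite. \<forall>i. y $ i \<in> N}"
proof -
  define E where "E = (\<Union>i::'n. axis i ` B)"
  have sub: "csubspace {y :: 'a ^ 'n. \<forall>i. y $ i \<in> N}"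
    unfolding assms(2) complex_vector.subspace_def
    by (auto simp: scaleC_vec_def intro: complex_vector.span_zero complex_vector.span_add complex_vector.span_scale)
  show ?thesis
  proof (rule finite_cdim_subspace[OF sub])
    show "finite E" using assms(1) by (simp add: E_def)
    show "{y :: 'a ^ 'n. \<forall>i. y $ i \<in> N} \<subseteq> cspan E"
    proof
      fix y :: "'a ^ 'n" assume y: "y \<in> {y. \<forall>i. y $ i \<in> N}"
      have ax: "bounded_clinear (axis i :: 'a \<Rightarrow> 'a ^ 'n)" for i
      proof -
        have "norm (axis i x :: 'a ^ 'n) \<le> norm x * 1" for x
          using norm_vec_le_sum[of "axis i x :: 'a ^ 'n"]
          by (simp add: axis_def if_distrib[of norm] cong: if_cong)
        then show ?thesis
          unfolding bounded_clinear_iff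
          by (intro conjI exI[of _ 1] allI) (auto simp: axis_def vec_eq_iff scaleC_vec_def)
      qed
      have "axis i (y $ i) \<in> cspan E" for i
      proof -
        have "axis i (y $ i) \<in> axis i ` cspan B" using y assms(2) by blast
        also have "\<dots> = cspan (axis i ` B)" by (rule image_cspan[OF ax])
        also have "\<dots> \<subseteq> cspan E" unfolding E_def by (intro complex_vector.span_mono) blast
        finally show ?thesis .
      qed
      then have "(\<Sum>i\<in>UNIV. axis i (y $ i)) \<in> cspan E" by (intro complex_vector.span_sum)
      moreover have "(\<Sum>i\<in>UNIV. axis i (y $ i)) = y"
        by (simp add: vec_eq_iff axis_def if_distrib[of "\<lambda>f. f $ _"] cong: if_cong)
      ultimately show "y \<in> cspan E" by simp
    qed
  qed
qed

lemma upper_split_semi_Browder_perturb: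
  fixes T :: "'n::finite \<Rightarrow> 'a \<Rightarrow> 'a::complex_banach"
  assumes T: "\<And>i. bounded_clinear (T i)" and comm: "\<And>i j. T i \<circ> T j = T j \<circ> T i"
    and upp: "upper_split_semi_Browder T"
  shows "\<exists>e>0. \<forall>w. real CARD('n) * norm w \<le> e \<longrightarrow> upper_split_semi_Browder (tuple_shift T w)"
proof -
  define N where "N = N_infinity T"
  have cl: "closed (range (tuple_tilde T))" and compl: "has_direct_complement (range (tuple_tilde T))"
    using upp by (auto simp: upper_split_semi_Browder_def)
  obtain B where B: "finite B" "N = cspan B"
    using upp unfolding upper_split_semi_Browder_def finite_cdim_def N_def by blast
  have Tz: "T i 0 = 0" for i by (rule module_hom.zero[OF bounded_clinear_module_hom[OF T]])
  have pow_zero: "(T i ^^ k) 0 = 0" for i k by (induction k) (auto simp: Tz)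
  have pow_mono: "(T i ^^ k) x = 0" if "(T i ^^ j) x = 0" "j \<le> k" for i j k x
    using funpow_add[of "k - j" j "T i"] that by (simp add: pow_zero)
  have N_iff: "x \<in> N \<longleftrightarrow> (\<exists>k\<ge>1. \<forall>i. (T i ^^ k) x = 0)" for x
    by (auto simp: N_def N_infinity_def)
  have NT: "x \<in> N" if "\<And>i. T i x \<in> N" for x
  proof -
    have "\<forall>i. \<exists>k. \<forall>j. (T j ^^ k) (T i x) = 0" using that by (auto simp: N_iff)
    then obtain k where k: "\<And>i j. (T j ^^ k i) (T i x) = 0" by metis
    \<comment> \<open>The exponent \<open>k i\<close> depends on \<open>i\<close>; the maximum over
      the finite index set serves all entries, and \<open>Suc\<close> accounts for the application
      of \<open>T i\<close> to \<open>x\<close>.\<close>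
    have "(T i ^^ Suc (Max (range k))) x = 0" for i
    proof -
      have "(T i ^^ Suc (k i)) x = 0" using k[of i i] by (simp add: funpow_swap1)
      then show ?thesis by (rule pow_mono) simp
    qed
    then show ?thesis unfolding N_iff by (intro exI[of _ "Suc (Max (range k))"]) auto
  qed
  have TN: "T i x \<in> N" if x: "x \<in> N" for i x
  proof -
    obtain k where "k \<ge> 1" "\<forall>j. (T j ^^ k) x = 0" using x unfolding N_iff by (elim exE conjE)
    then show ?thesis
      unfolding N_iff by (intro exI[of _ k]) (simp add: funpow_commute[OF comm] Tz)
  qed
  obtain W where W: "csubspace W" "closed W" "N + W = UNIV" "N \<inter> W = {0}"
    using closed_complement_of_cspan[OF B(1) complex_vector.subspace_UNIV closed_UNIV subset_UNIV]
    unfolding B(2) by (elim exE conjE)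
  \<comment> \<open>The power of \<open>N\<close> is written as the span of a finite set, so that it
    can take the place of \<open>cspan M\<close> in \<open>preimage_subset_perturb\<close>.\<close>
  obtain D where D: "finite D" "{y :: 'a ^ 'n. \<forall>i. y $ i \<in> N} = cspan D"
    using finite_cdim_vec[OF B] unfolding finite_cdim_def by blast
  have cspanD: "y \<in> cspan D \<longleftrightarrow> (\<forall>i. y $ i \<in> N)" for y unfolding D(2)[symmetric] by simp
  have N0: "0 \<in> N" unfolding B(2) by (rule complex_vector.span_zero)
  have ker: "null_space (tuple_tilde T) \<subseteq> cspan B"
  proof
    fix x assume "x \<in> null_space (tuple_tilde T)"
    then have "T i x = 0" for i by (auto simp: tuple_tilde_def vec_eq_iff)
    then show "x \<in> cspan B" unfolding B(2)[symmetric] using NT N0 by simp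
  qed
  obtain e where e: "e > 0" "\<forall>B. bounded_clinear B \<longrightarrow> (\<forall>x. norm (B x - tuple_tilde T x) \<le> e * norm x) \<longrightarrow>
      closed (range B) \<and> has_direct_complement (range B)"
    using range_complement_perturb[OF bounded_clinear_tuple_tilde[OF T] compl B(1) ker W(1,2)
        W(3,4)[unfolded B(2)]] by blast
  have img: "tuple_tilde T ` N \<subseteq> cspan D" using TN by (auto simp: cspanD tuple_tilde_def)
  have "\<exists>d>0. \<forall>B. bounded_clinear B \<longrightarrow> (\<forall>x. norm (B x - tuple_tilde T x) \<le> d * norm x) \<longrightarrow>
      B ` N \<subseteq> cspan D \<longrightarrow> (\<forall>x. B x \<in> cspan D \<longrightarrow> x \<in> N)"
  proof (rule preimage_subset_perturb[OF bounded_clinear_tuple_tilde[OF T] cl W D(1) img])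
    show "x \<in> N" if "tuple_tilde T x \<in> cspan D" for x
      by (rule NT) (use that in \<open>simp add: cspanD tuple_tilde_def\<close>)
  qed
  then obtain d where d: "d > 0"
      "\<forall>B. bounded_clinear B \<longrightarrow> (\<forall>x. norm (B x - tuple_tilde T x) \<le> d * norm x) \<longrightarrow>
      B ` N \<subseteq> cspan D \<longrightarrow> (\<forall>x. B x \<in> cspan D \<longrightarrow> x \<in> N)" by (elim exE conjE)
  show ?thesis
  proof (intro exI[of _ "min e d"] conjI allI impI)
    show "min e d > 0" using e d by simp
    fix w :: "complex ^ 'n" assume w: "real CARD('n) * norm w \<le> min e d"
    define S where "S = tuple_shift T w"
    have S: "bounded_clinear (S i)" for i unfolding S_def by (intro bounded_clinear_tuple_shift T)
    have commS: "S i \<circ> S j = S j \<circ> S i" for i j unfolding S_def by (intro commute_tuple_shift T comm)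
    have near: "norm (tuple_tilde S x - tuple_tilde T x) \<le> e * norm x"
      "norm (tuple_tilde S x - tuple_tilde T x) \<le> d * norm x" for x
      unfolding S_def
      by (rule order_trans[OF norm_tuple_tilde_shift_diff]; use w in \<open>intro mult_right_mono, auto\<close>)+
    have tS: "bounded_clinear (tuple_tilde S)" by (intro bounded_clinear_tuple_tilde S)
    have SN: "S i x \<in> N" if "x \<in> N" for i x
      using complex_vector.span_diff[OF TN[OF that, of i, unfolded B(2)]
          complex_vector.span_scale[OF that[unfolded B(2)], of "w $ i"]]
      unfolding B(2) S_def tuple_shift_def .
    have "tuple_tilde S ` N \<subseteq> cspan D" using SN by (auto simp: cspanD tuple_tilde_def)
    then have pre: "x \<in> N" if "tuple_tilde S x \<in> cspan D" for x
      by (rule d(2)[rule_format, OF tS near(2) _ that])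
    have NS: "x \<in> N" if "\<And>i. S i x \<in> N" for x
      by (rule pre) (use that in \<open>simp add: cspanD tuple_tilde_def\<close>)
    have sub: "N_infinity S \<subseteq> N"
    proof
      fix x assume "x \<in> N_infinity S"
      then obtain k where k: "\<forall>i. (S i ^^ k) x = 0" by (auto simp: N_infinity_def)
      show "x \<in> N"
        by (rule joint_power_kernel_subset[of S, OF S commS N0 _ k[rule_format]]) (rule NS)
    qed
    have Sz: "S i 0 = 0" for i by (rule module_hom.zero[OF bounded_clinear_module_hom[OF S]])
    have Spz: "(S i ^^ k) 0 = 0" for i k by (induction k) (auto simp: Sz)
    have "csubspace (N_infinity S)"
      unfolding complex_vector.subspace_def
    proof (intro conjI ballI allI)
      show "0 \<in> N_infinity S" using Spz by (auto simp: N_infinity_def)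
      fix x y assume "x \<in> N_infinity S" "y \<in> N_infinity S"
      then obtain j k where jk: "j \<ge> 1" "\<And>i. (S i ^^ j) x = 0" "\<And>i. (S i ^^ k) y = 0"
        by (auto simp: N_infinity_def)
      \<comment> \<open>The two vectors may die at different exponents; \<open>j + k\<close>
        annihilates both under every entry.\<close>
      have "(S i ^^ (j + k)) x = 0" "(S i ^^ (j + k)) y = 0" for i
        using jk Spz fun_cong[OF funpow_add[of k j "S i"], of x] fun_cong[OF funpow_add[of j k "S i"], of y]
        by (simp_all add: add.commute[of k j])
      then have "(S i ^^ (j + k)) (x + y) = 0" for i
        using module_hom.add[OF bounded_clinear_module_hom[OF bounded_clinear_power[OF S]]] by simp
      then show "x + y \<in> N_infinity S" using jk(1) unfolding N_infinity_def by (auto intro!: bexI[of _ "j + k"])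
    next
      fix c x assume "x \<in> N_infinity S"
      then obtain j where "j \<ge> 1" "\<And>i. (S i ^^ j) x = 0" by (auto simp: N_infinity_def)
      then show "c *\<^sub>C x \<in> N_infinity S"
        using module_hom.scale[OF bounded_clinear_module_hom[OF bounded_clinear_power[OF S]]]
        unfolding N_infinity_def by (auto intro!: bexI[of _ j])
    qed
    then have fin: "finite_cdim (N_infinity S)" using sub B by (intro finite_cdim_subspace) auto
    have "null_space (tuple_tilde S) \<subseteq> N"
    proof
      fix x assume "x \<in> null_space (tuple_tilde S)"
      then have "S i x = 0" for i by (auto simp: tuple_tilde_def vec_eq_iff)
      then show "x \<in> N" by (intro NS[of x]) (simp add: N0)
    qed
    then have "finite_cdim (null_space (tuple_tilde S))"
      using B by (intro finite_cdim_subspace csubspace_null_space tS) auto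
    then show "upper_split_semi_Browder (tuple_shift T w)"
      using fin e(2) tS near(1) unfolding upper_split_semi_Browder_def S_def by blast
  qed
qed

section \<open>Tuples with an invertible entry, and compactness\<close>

lemma shift_surj_bounded_below:
  fixes f :: "'a \<Rightarrow> 'a::complex_banach"
  assumes f: "bounded_clinear f" "\<And>x. norm (f x) \<le> norm x * K" and c: "K < cmod c" "0 \<le> K"
  shows "surj (\<lambda>x. f x - c *\<^sub>C x)" "\<And>x. (cmod c - K) * norm x \<le> norm (f x - c *\<^sub>C x)"
proof -
  show "(cmod c - K) * norm x \<le> norm (f x - c *\<^sub>C x)" for x
    using norm_triangle_ineq2[of "c *\<^sub>C x" "f x"] f(2)[of x]
    by (simp add: norm_scaleC norm_minus_commute algebra_simps)
  have m: "bounded_clinear (\<lambda>x. - c *\<^sub>C x)"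
    unfolding bounded_clinear_iff
    by (auto simp: scaleC_add_right scaleC_scaleC mult.commute norm_scaleC intro!: exI[of _ "cmod c"])
  have g: "bounded_linear (\<lambda>x. f x - c *\<^sub>C x)"
    using bounded_linear_add[OF bounded_clinear_imp_bounded_linear[OF f(1)]
        bounded_clinear_imp_bounded_linear[OF m]] by simp
  have c0: "c \<noteq> 0" using c by auto
  show "surj (\<lambda>x. f x - c *\<^sub>C x)"
  \<comment> \<open>The operator is a perturbation of \<open>- c\<close> times the identity, whose
    inverse has bound \<open>1 / cmod c\<close>; the contraction factor \<open>K / cmod c\<close> is
    below 1.\<close>
  proof (rule perturb_onto[OF bounded_clinear_imp_bounded_linear[OF m] g subspace_UNIV closed_UNIV subspace_UNIV,
        of "1 / cmod c" K])
    fix y :: 'a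
    have "norm ((- inverse c) *\<^sub>C y) = 1 / cmod c * norm y"
      by (simp add: norm_scaleC norm_divide inverse_eq_divide del: complex_vector.scale_minus_left)
    moreover have "- c *\<^sub>C (- inverse c) *\<^sub>C y = y" using c0 by (simp add: scaleC_scaleC scaleC_one)
    ultimately show "\<exists>x\<in>UNIV. - c *\<^sub>C x = y \<and> norm x \<le> 1 / cmod c * norm y"
      by (metis UNIV_I order_refl)
  qed (use c c0 f(2) in \<open>auto simp: field_simps\<close>)
qed

text \<open>The powers of \<open>S j\<close> are onto, so \<open>R_infinity S\<close> is the whole
  space. On the \<open>j\<close>-th coordinate axis the row operator acts as the bijection
  \<open>S j\<close>, so this axis complements its kernel.\<close>

lemma lower_split_semi_Browder_if_bijective:
  fixes S :: "'n::finite \<Rightarrow> 'a \<Rightarrow> 'a::complex_banach"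
  assumes S: "\<And>i. bounded_clinear (S i)" and surj: "surj (S j)" and inj: "\<And>x. S j x = 0 \<Longrightarrow> x = 0"
  shows "lower_split_semi_Browder S"
  unfolding lower_split_semi_Browder_def
proof
  have "x \<in> R_infinity S" for x
    unfolding R_infinity_eq
  proof (intro INT_I)
    fix k
    have "surj (S j ^^ k)" using surj by (rule surj_fn)
    then obtain u where "x = (S j ^^ k) u" by (metis surjD)
    then show "x \<in> range (tuple_hat (\<lambda>i. S i ^^ k))"
      using in_range_tuple_hat_single[of "\<lambda>i. S i ^^ k", OF bounded_clinear_power[OF S]] by simp
  qed
  then have "R_infinity S + cspan {} = UNIV" by (auto simp: set_plus_def)
  then show "finite_ccodim (R_infinity S)" unfolding finite_ccodim_iff by blast
next
  have z: "S i 0 = 0" for i by (rule module_hom.zero[OF bounded_clinear_module_hom[OF S]])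
  define L where "L = {x :: 'a ^ 'n. \<forall>i. i \<noteq> j \<longrightarrow> x $ i = 0}"
  have hat: "tuple_hat S (axis j u) = S j u" for u
    unfolding tuple_hat_def by (subst sum.remove[of _ j]) (auto simp: axis_def z intro: sum.neutral)
  have L: "x = axis j (x $ j)" if "x \<in> L" for x
    using that by (auto simp: L_def axis_def vec_eq_iff)
  show "has_direct_complement (null_space (tuple_hat S))"
    unfolding has_direct_complement_def
  proof (intro exI[of _ L] conjI)
    show "csubspace L" by (auto simp: L_def complex_vector.subspace_def scaleC_vec_def)
    have "L = (\<Inter>i\<in>- {j}. (\<lambda>x. x $ i) -` {0})" by (auto simp: L_def)
    then show "closed L" by (auto intro!: closed_INT closed_vimage continuous_intros)
    show "null_space (tuple_hat S) + L = UNIV"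
    proof (intro set_eqI iffI UNIV_I)
      fix x
      obtain u where u: "S j u = tuple_hat S x" using surj by (metis surjD)
      have "x - axis j u \<in> null_space (tuple_hat S)"
        using module_hom.diff[OF bounded_clinear_module_hom[OF bounded_clinear_tuple_hat[of S, OF S]]] hat u by simp
      moreover have "axis j u \<in> L" by (auto simp: L_def axis_def)
      ultimately have "(x - axis j u) + axis j u \<in> null_space (tuple_hat S) + L" by (intro set_plus_intro)
      then show "x \<in> null_space (tuple_hat S) + L" by simp
    qed
    show "null_space (tuple_hat S) \<inter> L = {0}"
    proof
      show "null_space (tuple_hat S) \<inter> L \<subseteq> {0}"
      proof
        fix x assume x: "x \<in> null_space (tuple_hat S) \<inter> L"
        then have "S j (x $ j) = 0" using L[of x] hat[of "x $ j"] by auto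
        then have "x $ j = 0" by (rule inj)
        moreover have "x = axis j (x $ j)" using x by (intro L) simp
        ultimately have "x = axis j 0" by simp
        then show "x \<in> {0}" by (simp add: axis_def vec_eq_iff)
      qed
      show "{0} \<subseteq> null_space (tuple_hat S) \<inter> L" by (auto simp: L_def tuple_hat_def z)
    qed
  qed
qed

text \<open>The column operator inherits the lower bound of \<open>S j\<close>, so its range is
  closed. The vectors with zero \<open>j\<close>-th coordinate complement the range, because the
  bijection \<open>S j\<close> makes an element of the range determined by its \<open>j\<close>-th
  coordinate, which can be prescribed.\<close>

lemma upper_split_semi_Browder_if_bounded_below:
  fixes S :: "'n::finite \<Rightarrow> 'a \<Rightarrow> 'a::complex_banach"
  assumes S: "\<And>i. bounded_clinear (S i)" and surj: "surj (S j)"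
    and d: "d > 0" "\<And>x. d * norm x \<le> norm (S j x)"
  shows "upper_split_semi_Browder S"
proof -
  have z: "S i 0 = 0" for i by (rule module_hom.zero[OF bounded_clinear_module_hom[OF S]])
  have inj: "x = 0" if "S j x = 0" for x
  proof -
    have "d * norm x \<le> 0" using d(2)[of x] that by simp
    then show ?thesis using d(1) by (simp add: mult_le_0_iff)
  qed
  have injpow: "x = 0" if "(S j ^^ k) x = 0" for x k
    using that by (induction k) (auto dest: inj)
  have injpow': "x = 0" if "\<forall>i. (S i ^^ k) x = 0" for x k
    using that injpow by blast
  have tS: "bounded_clinear (tuple_tilde S)" by (intro bounded_clinear_tuple_tilde S)
  have zpow: "(S i ^^ k) 0 = 0" for i k by (induction k) (auto simp: z)
  have ker: "null_space (tuple_tilde S) = {0}"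
    using inj z by (auto simp: tuple_tilde_def vec_eq_iff)
  have Ninf: "N_infinity S = {0}"
    using injpow' zpow by (auto simp: N_infinity_def)
  have zero: "finite_cdim {0 :: 'a}" unfolding finite_cdim_def by (intro exI[of _ "{}"]) simp
  have low: "d * norm x \<le> norm (tuple_tilde S x)" for x
    using d(2)[of x] Finite_Cartesian_Product.norm_nth_le[of "tuple_tilde S x" j] by (simp add: tuple_tilde_def)
  have "complete (range (tuple_tilde S))"
    by (rule complete_isometric_image[OF d(1) subspace_UNIV bounded_clinear_imp_bounded_linear[OF tS]])
      (use low complete_UNIV in auto)
  then have cl: "closed (range (tuple_tilde S))" by (simp add: complete_eq_closed)
  define L where "L = {y :: 'a ^ 'n. y $ j = 0}"
  have "has_direct_complement (range (tuple_tilde S))"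
    unfolding has_direct_complement_def
  proof (intro exI[of _ L] conjI)
    show "csubspace L" by (auto simp: L_def complex_vector.subspace_def scaleC_vec_def)
    have "L = (\<lambda>x. x $ j) -` {0}" by (auto simp: L_def)
    then show "closed L" by (auto intro!: closed_vimage continuous_intros)
    show "range (tuple_tilde S) + L = UNIV"
    proof (intro set_eqI iffI UNIV_I)
      fix y :: "'a ^ 'n"
      obtain u where u: "S j u = y $ j" using surj by (metis surjD)
      have "tuple_tilde S u + (y - tuple_tilde S u) \<in> range (tuple_tilde S) + L"
        by (intro set_plus_intro) (auto simp: L_def tuple_tilde_def u)
      then show "y \<in> range (tuple_tilde S) + L" by simp
    qed
    show "range (tuple_tilde S) \<inter> L = {0}"
    proof
      show "range (tuple_tilde S) \<inter> L \<subseteq> {0}"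
        using inj z by (auto simp: L_def tuple_tilde_def vec_eq_iff) metis
      show "{0} \<subseteq> range (tuple_tilde S) \<inter> L"
        using complex_vector.subspace_0[OF csubspace_range[OF tS]] by (auto simp: L_def)
    qed
  qed
  then show ?thesis unfolding upper_split_semi_Browder_def ker Ninf using zero cl by blast
qed

text \<open>Leaving \<open>P\<close> abstract lets one argument serve both spectra:
  \<open>invertible\<close> bounds the set coordinate by coordinate, and \<open>stable\<close>,
  applied to the shifted tuples, makes its complement open because shifts add up.\<close>

lemma compact_tuple_spectrum:
  fixes T :: "'n::finite \<Rightarrow> 'a \<Rightarrow> 'a::complex_banach" and P :: "('n \<Rightarrow> 'a \<Rightarrow> 'a) \<Rightarrow> bool"
  assumes T: "\<And>i. bounded_clinear (T i)" and comm: "\<And>i j. T i \<circ> T j = T j \<circ> T i"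
    and stable: "\<And>S. (\<And>i. bounded_clinear (S i)) \<Longrightarrow> (\<And>i j. S i \<circ> S j = S j \<circ> S i) \<Longrightarrow> P S \<Longrightarrow>
      \<exists>e>0. \<forall>w. real CARD('n) * norm w \<le> e \<longrightarrow> P (tuple_shift S w)"
    and invertible: "\<And>S j d. (\<And>i. bounded_clinear (S i)) \<Longrightarrow> surj (S j) \<Longrightarrow> d > 0 \<Longrightarrow>
      (\<And>x. d * norm x \<le> norm (S j x)) \<Longrightarrow> P S"
  shows "compact {z. \<not> P (tuple_shift T z)}"
  unfolding compact_eq_bounded_closed
proof
  have "\<exists>K\<ge>0. \<forall>x. norm (T i x) \<le> norm x * K" for i
    using bounded_linear.nonneg_bounded[OF bounded_clinear_imp_bounded_linear[OF T]] .
  then obtain K where K: "\<And>i. K i \<ge> 0" "\<And>i x. norm (T i x) \<le> norm x * K i" by metis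
  \<comment> \<open>A single coordinate beyond the bound of its operator already gives the shifted
    tuple an invertible entry, so every coordinate is bounded separately.\<close>
  have "cmod (z $ j) \<le> K j" if "\<not> P (tuple_shift T z)" for z j
  proof (rule ccontr)
    assume "\<not> cmod (z $ j) \<le> K j"
    then have j: "K j < cmod (z $ j)" by simp
    have eq: "tuple_shift T z j = (\<lambda>x. T j x - (z $ j) *\<^sub>C x)" by (simp add: fun_eq_iff tuple_shift_def)
    have "P (tuple_shift T z)"
    proof (rule invertible)
      show "bounded_clinear (tuple_shift T z i)" for i by (intro bounded_clinear_tuple_shift T)
      show "surj (tuple_shift T z j)" unfolding eq by (rule shift_surj_bounded_below(1)[OF T K(2) j K(1)])
      show "(cmod (z $ j) - K j) * norm x \<le> norm (tuple_shift T z j x)" for x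
        unfolding eq by (rule shift_surj_bounded_below(2)[OF T K(2) j K(1)])
    qed (use j in simp)
    then show False using that by simp
  qed
  then have "norm z \<le> (\<Sum>i\<in>UNIV. K i)" if "\<not> P (tuple_shift T z)" for z
    using that by (intro order_trans[OF norm_vec_le_sum] sum_mono)
  then show "bounded {z. \<not> P (tuple_shift T z)}" unfolding bounded_iff by blast
  have "open {z. P (tuple_shift T z)}"
    unfolding open_dist
  proof
    fix z assume "z \<in> {z. P (tuple_shift T z)}"
    then have "P (tuple_shift T z)" by simp
    then obtain e where e: "e > 0"
        "\<forall>w. real CARD('n) * norm w \<le> e \<longrightarrow> P (tuple_shift (tuple_shift T z) w)"
      using stable[of "tuple_shift T z", OF bounded_clinear_tuple_shift[OF T] commute_tuple_shift[OF T comm]]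
      by blast
    show "\<exists>r>0. \<forall>y. dist y z < r \<longrightarrow> y \<in> {z. P (tuple_shift T z)}"
    proof (intro exI[of _ "e / real CARD('n)"] conjI allI impI)
      show "e / real CARD('n) > 0" using e by simp
      fix y assume "dist y z < e / real CARD('n)"
      then have "real CARD('n) * norm (y - z) \<le> e" by (simp add: dist_norm field_simps)
      then have "P (tuple_shift T (z + (y - z)))" using e(2) unfolding tuple_shift_shift by blast
      then show "y \<in> {z. P (tuple_shift T z)}" by simp
    qed
  qed
  moreover have "{z. \<not> P (tuple_shift T z)} = - {z. P (tuple_shift T z)}" by auto
  ultimately show "closed {z. \<not> P (tuple_shift T z)}" by (simp add: closed_def)
qed

theorem proposition3p1:
  fixes T :: "'n::finite \<Rightarrow> 'a \<Rightarrow> 'a::complex_banach"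
  assumes "\<And>i. bounded_clinear (T i)"
    and "\<And>i j. T i \<circ> T j = T j \<circ> T i"
  shows "compact (sp_lower_split T) \<and> compact (sp_upper_split T)"
proof
  show "compact (sp_lower_split T)"
    unfolding sp_lower_split_def
  proof (rule compact_tuple_spectrum[OF assms])
    fix S :: "'n \<Rightarrow> 'a \<Rightarrow> 'a" and j and d :: real
    assume S: "\<And>i. bounded_clinear (S i)" "surj (S j)" and d: "d > 0" "\<And>x. d * norm x \<le> norm (S j x)"
    show "lower_split_semi_Browder S"
    proof (rule lower_split_semi_Browder_if_bijective[of S j, OF S])
      show "x = 0" if "S j x = 0" for x
        using d(1) d(2)[of x] that by (simp add: mult_le_0_iff)
    qed
  qed (rule lower_split_semi_Browder_perturb)
  show "compact (sp_upper_split T)"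
    unfolding sp_upper_split_def
  proof (rule compact_tuple_spectrum[OF assms])
    fix S :: "'n \<Rightarrow> 'a \<Rightarrow> 'a" and j and d :: real
    assume S: "\<And>i. bounded_clinear (S i)" "surj (S j)" and d: "d > 0" "\<And>x. d * norm x \<le> norm (S j x)"
    show "upper_split_semi_Browder S"
      by (rule upper_split_semi_Browder_if_bounded_below[of S j, OF S d])
  qed (rule upper_split_semi_Browder_perturb)
qed

end
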